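(* Let $k>0$, $L>0$, $d>0$, $\sigma_0,\sigma_1>0$ and $g\in L^2(0,\pi)$. Let $U$ be the (outgoing) solution of the semi-infinite waveguide problem and let $U_{\rm a}$ be the solution of the PAL-problem, both described in the context. Then $$U_{\rm a}(x,y)\equiv U(x,y),\qquad \forall\,(x,y)\in\Omega=(0,L)\times(0,\pi).$$
   Context: Waveguide problem: $\Delta U+k^2U=0$ in $\{0<x<\infty,\ 0<y<\pi\}$, with $U(x,0)=U(x,\pi)=0$ for $x\ge0$, $U(0,y)=g(y)$ for $y\in[0,\pi]$, and $U$ outgoing as $x\to\infty$. Its solution is $U(x,y)=\sum_{l=1}^\infty \hat g_l e^{\mathrm{i}\hat k_l x}\sin(ly)$, with $\hat g_l=\frac2\pi\int_0^\pi g(y)\sin(ly)\,dy$ and $\hat k_l=\sqrt{k^2-l^2}$ ($=\mathrm{i}\sqrt{l^2-k^2}$ for $l>k$). Complex compression coordinate transformation: $S(x)=x$ for $x\in(0,L)$ and $$S(x)=\sigma_1\rho(x)+\frac{\mathrm{i}\,\sigma_0}{k}\big(\rho(x)-L\big),\qquad \rho(x)=L+\frac{d(x-L)}{L+d-x},\qquad x\in(L,L+d).$$ PAL-problem: with $\Omega=(0,L)\times(0,\pi)$ and $\Omega_d=(L,L+d)\times(0,\pi)$, $U_{\rm a}$ solves $$\frac{\partial}{\partial x}\Big(\frac{1}{S'(x)}\frac{\partial U_{\rm a}}{\partial x}\Big)+\frac{\partial}{\partial y}\Big(S'(x)\frac{\partial U_{\rm a}}{\partial y}\Big)+k^2S'(x)U_{\rm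 a}=0\quad\text{in }\Omega\cup\Omega_d,$$ with transmission conditions at $x=L$: $U_{\rm a}|_\Omega=U_{\rm a}|_{\Omega_d}$ and $\frac{\partial U_{\rm a}}{\partial x}\big|_\Omega=\frac1{S'(x)}\frac{\partial U_{\rm a}}{\partial x}\big|_{\Omega_d}$, and boundary conditions $U_{\rm a}(x,0)=U_{\rm a}(x,\pi)=0$, $U_{\rm a}(0,y)=g(y)$, $U_{\rm a}(L+d,y)=0$. *)

theory Defs
  imports "HOL-Analysis.Analysis"
begin

text \<open>Partial derivatives of a complex-valued function of the two real variables \<open>x\<close> and \<open>y\<close>.\<close>

definition pdx :: "(real \<Rightarrow> real \<Rightarrow> complex) \<Rightarrow> real \<Rightarrow> real \<Rightarrow> complex"
  where "pdx f x y = vector_derivative (\<lambda>s. f s y) (at x)"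

definition pdy :: "(real \<Rightarrow> real \<Rightarrow> complex) \<Rightarrow> real \<Rightarrow> real \<Rightarrow> complex"
  where "pdy f x y = vector_derivative (\<lambda>t. f x t) (at y)"

definition C1_on :: "(real \<times> real) set \<Rightarrow> (real \<Rightarrow> real \<Rightarrow> complex) \<Rightarrow> bool"
  where "C1_on D f \<longleftrightarrow>
    (\<forall>(x, y)\<in>D. (\<lambda>s. f s y) differentiable (at x) \<and> (\<lambda>t. f x t) differentiable (at y)) \<and>
    continuous_on D (\<lambda>(x, y). f x y) \<and>
    continuous_on D (\<lambda>(x, y). pdx f x y) \<and>
    continuous_on D (\<lambda>(x, y). pdy f x y)"

definition C2_on :: "(real \<times> real) set \<Rightarrow> (real \<Rightarrow> real \<Rightarrow> complex) \<Rightarrow> bool"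
  where "C2_on D f \<longleftrightarrow> C1_on D f \<and> C1_on D (pdx f) \<and> C1_on D (pdy f)"

definition square_integrable :: "(real \<Rightarrow> complex) \<Rightarrow> bool"  \<comment> \<open>the space \<open>L\<^sup>2(0,\<pi>)\<close>\<close>
  where "square_integrable f \<longleftrightarrow>
    f \<in> borel_measurable (lebesgue_on {0<..<pi}) \<and>
    integrable (lebesgue_on {0<..<pi}) (\<lambda>y. (norm (f y))\<^sup>2)"

text \<open>
  Convergence in \<open>L\<^sup>2(0,\<pi>)\<close> of the cross-sections \<open>f x\<close> along the filter \<open>F\<close>. Since the data
  on the vertical sides are only square integrable, every condition on a line \<open>x = const\<close> is
  imposed on the trace in this sense.
\<close>

definition L2_tendsto ::
    "(real \<Rightarrow> real \<Rightarrow> complex) \<Rightarrow> (real \<Rightarrow> complex) \<Rightarrow> real filter \<Rightarrow> bool"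
  where "L2_tendsto f h F \<longleftrightarrow>
    square_integrable h \<and> eventually (\<lambda>x. square_integrable (f x)) F \<and>
    ((\<lambda>x. integral\<^sup>L (lebesgue_on {0<..<pi}) (\<lambda>y. (norm (f x y - h y))\<^sup>2)) \<longlongrightarrow> 0) F"

text \<open>
  The principal square root gives \<open>\<i> * sqrt (l\<^sup>2 - k\<^sup>2)\<close> for \<open>l > k\<close>.
\<close>

definition khat :: "real \<Rightarrow> nat \<Rightarrow> complex"
  where "khat k l = csqrt (complex_of_real (k\<^sup>2 - (real l)\<^sup>2))"

definition sine_coeff :: "nat \<Rightarrow> (real \<Rightarrow> complex) \<Rightarrow> complex"
  where "sine_coeff l f =
    complex_of_real (2 / pi) * integral {0..pi} (\<lambda>y. f y * complex_of_real (sin (real l * y)))"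

text \<open>
  Modal Sommerfeld radiation condition. Of the two independent solutions of each modal equation
  it admits only multiples of \<open>exp (\<i> * khat k l * x)\<close>: it excludes the incoming wave for
  \<open>l < k\<close>, the exponentially growing solution for \<open>l > k\<close> and the linearly growing one for
  \<open>l = k\<close>.
\<close>

definition outgoing :: "real \<Rightarrow> (real \<Rightarrow> real \<Rightarrow> complex) \<Rightarrow> bool"
  where "outgoing k U \<longleftrightarrow>
    (\<forall>l\<ge>1. ((\<lambda>x. vector_derivative (\<lambda>s. sine_coeff l (U s)) (at x)
                 - \<i> * khat k l * sine_coeff l (U x)) \<longlongrightarrow> 0) at_top)"

definition waveguide_solution ::
    "real \<Rightarrow> (real \<Rightarrow> complex) \<Rightarrow> (real \<Rightarrow> real \<Rightarrow> complex) \<Rightarrow> bool"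
  where "waveguide_solution k g U \<longleftrightarrow>
    C2_on ({0<..} \<times> {0<..<pi}) U \<and>
    continuous_on ({0<..} \<times> {0..pi}) (\<lambda>(x, y). U x y) \<and>
    (\<forall>x\<in>{0<..}. \<forall>y\<in>{0<..<pi}.
       pdx (pdx U) x y + pdy (pdy U) x y + (complex_of_real k)\<^sup>2 * U x y = 0) \<and>
    (\<forall>x\<in>{0<..}. U x 0 = 0 \<and> U x pi = 0) \<and>
    L2_tendsto U g (at_right 0) \<and>
    outgoing k U"

definition pal_rho :: "real \<Rightarrow> real \<Rightarrow> real \<Rightarrow> real"
  where "pal_rho L d x = L + d * (x - L) / (L + d - x)"

text \<open>
  Only \<open>0 < x < L\<close> and \<open>L < x < L + d\<close> matter; for \<open>\<sigma>\<^sub>1 \<noteq> 1\<close> the function jumps at \<open>x = L\<close>.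
\<close>

definition pal_S :: "real \<Rightarrow> real \<Rightarrow> real \<Rightarrow> real \<Rightarrow> real \<Rightarrow> real \<Rightarrow> complex"
  where "pal_S k L d \<sigma>\<^sub>0 \<sigma>\<^sub>1 x =
    (if x \<le> L then complex_of_real x
     else complex_of_real (\<sigma>\<^sub>1 * pal_rho L d x)
          + \<i> * complex_of_real (\<sigma>\<^sub>0 / k) * complex_of_real (pal_rho L d x - L))"

definition pal_S' :: "real \<Rightarrow> real \<Rightarrow> real \<Rightarrow> real \<Rightarrow> real \<Rightarrow> real \<Rightarrow> complex"
  where "pal_S' k L d \<sigma>\<^sub>0 \<sigma>\<^sub>1 x = vector_derivative (pal_S k L d \<sigma>\<^sub>0 \<sigma>\<^sub>1) (at x)"

text \<open>
  The existentially quantified \<open>h\<close> and \<open>v\<close> are the common traces at the interface \<open>x = L\<close> of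
  the field and of the flux.
\<close>

definition pal_solution ::
    "real \<Rightarrow> real \<Rightarrow> real \<Rightarrow> real \<Rightarrow> real \<Rightarrow> (real \<Rightarrow> complex) \<Rightarrow> (real \<Rightarrow> real \<Rightarrow> complex) \<Rightarrow> bool"
  where "pal_solution k L d \<sigma>\<^sub>0 \<sigma>\<^sub>1 g U \<longleftrightarrow>
    (let S' = pal_S' k L d \<sigma>\<^sub>0 \<sigma>\<^sub>1; I = {0<..<L} \<union> {L<..<L + d} in
      C2_on (I \<times> {0<..<pi}) U \<and>
      continuous_on (I \<times> {0..pi}) (\<lambda>(x, y). U x y) \<and>
      (\<forall>x\<in>I. \<forall>y\<in>{0<..<pi}.
         pdx (\<lambda>s t. 1 / S' s * pdx U s t) x y + pdy (\<lambda>s t. S' s * pdy U s t) x y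
         + (complex_of_real k)\<^sup>2 * S' x * U x y = 0) \<and>
      (\<exists>h. L2_tendsto U h (at_left L) \<and> L2_tendsto U h (at_right L)) \<and>
      (\<exists>v. L2_tendsto (pdx U) v (at_left L) \<and>
           L2_tendsto (\<lambda>x y. 1 / S' x * pdx U x y) v (at_right L)) \<and>
      (\<forall>x\<in>I. U x 0 = 0 \<and> U x pi = 0) \<and>
      L2_tendsto U g (at_right 0) \<and>
      L2_tendsto U (\<lambda>_. 0) (at_left (L + d)))"

end

theory Submission
  imports Defs
begin

text \<open>
  Separation of variables. The sine coefficients \<open>m\<close> of a solution satisfy \<open>m'' = (\<i> c k\<^sub>l)\<^sup>2 m\<close>,
  where \<open>k\<^sub>l = khat k l\<close>, with \<open>c = 1\<close> in the waveguide and, in the stretched variable \<open>r = \<rho>(x) - L\<close>, with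
  \<open>c = \<sigma>\<^sub>1 + \<i> \<sigma>\<^sub>0 / k\<close> in the layer. The layer is thus a half-line with complex speed on which only
  \<open>exp (\<i> c k\<^sub>l r)\<close> tends to 0. The transmission conditions turn this into \<open>m' = \<i> k\<^sub>l m\<close> at \<open>x = L\<close>,
  which is what the radiation condition imposes on the waveguide solution. Hence both solutions have
  the sine coefficients \<open>g\<^sub>l exp (\<i> k\<^sub>l x)\<close> on \<open>(0, L)\<close>, and the sine system is complete.
\<close>

subsection \<open>Limits of second derivatives, linear equations and the sine system\<close>

text \<open>The derivatives of a solution are controlled only inside the strip: up to the walls
  \<open>y = 0\<close> and \<open>y = pi\<close> merely the function itself is continuous. So the
  integral defining a sine coefficient can neither be differentiated twice nor integrated by parts
  directly. The modal equation is derived for contracted moments. It survives the limit because the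
  differential equation expresses their second derivatives by values of the function, and
  convergence of functions and of second derivatives forces convergence of the first ones. The flux
  condition asks for more, since it speaks of coefficients of the x-derivative. These equal the
  derivative of the coefficient wherever the cross-section of the x-derivative is square integrable,
  which the convergence of the flux traces ensures near the interface. The parameters of the layer
  leave no mark on \<open>(0, L)\<close> because the flux in the layer is 1/c times the derivative
  in r: decay puts a factor c into m', and the flux condition divides out the same c.\<close>

text \<open>Subtracting from \<open>f n\<close> its tangent at \<open>a\<close> leaves a function
  determined by \<open>f2 n\<close>, and these converge. The one remaining unknown, the slope
  \<open>f1 n a\<close>, is read off from the convergence of \<open>f n\<close> at the two
  endpoints.\<close>

lemma second_derivative_limit_Icc:
  fixes f f1 f2 :: "nat \<Rightarrow> real \<Rightarrow> complex"
  assumes "a < b"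
    and d1: "\<And>n x. x \<in> {a..b} \<Longrightarrow> (f n has_vector_derivative f1 n x) (at x within {a..b})"
    and d2: "\<And>n x. x \<in> {a..b} \<Longrightarrow> (f1 n has_vector_derivative f2 n x) (at x within {a..b})"
    and lim2: "uniform_limit {a..b} f2 F sequentially"
    and lim0: "\<And>x. x \<in> {a..b} \<Longrightarrow> (\<lambda>n. f n x) \<longlonglongrightarrow> u x"
  obtains u1 where "\<And>x. x \<in> {a..b} \<Longrightarrow> (\<lambda>n. f1 n x) \<longlonglongrightarrow> u1 x"
    and "\<And>x. x \<in> {a..b} \<Longrightarrow> (u has_vector_derivative u1 x) (at x within {a..b})"
    and "\<And>x. x \<in> {a..b} \<Longrightarrow> (u1 has_vector_derivative F x) (at x within {a..b})"
proof -
  have a: "a \<in> {a..b}" and b: "b \<in> {a..b}" using \<open>a < b\<close> by auto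
  \<comment> \<open>The value at \<open>a\<close> is subtracted to have convergence at one point;
    \<open>f1 n a\<close> is not yet known to converge.\<close>
  define q where "q = (\<lambda>n x. f1 n x - f1 n a)"
  have "\<exists>G. \<forall>x\<in>{a..b}. (\<lambda>n. q n x) \<longlonglongrightarrow> G x \<and>
      (G has_derivative (\<lambda>h. h *\<^sub>R F x)) (at x within {a..b})"
  proof (rule has_derivative_sequence[where f' = "\<lambda>n x h. h *\<^sub>R f2 n x" and ?x0.0 = a and l = 0])
    show "(q n has_derivative (\<lambda>h. h *\<^sub>R f2 n x)) (at x within {a..b})"
      if "x \<in> {a..b}" for n x
      using has_vector_derivative_diff[OF d2[OF that] has_vector_derivative_const, of n "f1 n a"]
      unfolding q_def has_vector_derivative_def by simp
    show "\<forall>\<^sub>F n in sequentially. \<forall>x\<in>{a..b}. \<forall>h. norm (h *\<^sub>R f2 n x - h *\<^sub>R F x) \<le> e * norm h"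
      if "0 < e" for e
      using uniform_limitD[OF lim2 that]
    proof eventually_elim
      case (elim n)
      show ?case
      proof safe
        fix x h assume "x \<in> {a..b}"
        then have "norm (f2 n x - F x) \<le> e" using elim by (auto simp: dist_norm less_imp_le)
        then have "\<bar>h\<bar> * norm (f2 n x - F x) \<le> \<bar>h\<bar> * e" by (intro mult_left_mono) auto
        then show "norm (h *\<^sub>R f2 n x - h *\<^sub>R F x) \<le> e * norm h"
          by (simp add: scaleR_right_diff_distrib[symmetric] mult.commute)
      qed
    qed
    show "(\<lambda>n. q n a) \<longlonglongrightarrow> 0" by (simp add: q_def)
  qed (use a in auto)
  then obtain G where G: "\<And>x. x \<in> {a..b} \<Longrightarrow> (\<lambda>n. q n x) \<longlonglongrightarrow> G x"
    and G': "\<And>x. x \<in> {a..b} \<Longrightarrow> (G has_vector_derivative F x) (at x within {a..b})"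
    unfolding has_vector_derivative_def by blast
  have qd: "(q n has_vector_derivative f2 n x) (at x within {a..b})" if "x \<in> {a..b}" for n x
    using has_vector_derivative_diff[OF d2[OF that] has_vector_derivative_const, of n "f1 n a"]
    unfolding q_def by simp
  \<comment> \<open>\<open>has_derivative_sequence\<close> yields only pointwise convergence of
    \<open>q\<close>. Its second application needs uniform convergence, which a mean value bound
    over a length of at most \<open>b - a\<close> provides.\<close>
  have Gu: "\<forall>\<^sub>F n in sequentially. \<forall>x\<in>{a..b}. norm (q n x - G x) \<le> e" if "0 < e" for e
  proof -
    define e' where "e' = e / (b - a)"
    have "e' > 0" using that \<open>a < b\<close> by (simp add: e'_def)
    from uniform_limitD[OF lim2 this] show ?thesis
    proof eventually_elim
      case (elim n)
      show ?case
      proof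
        fix x assume x: "x \<in> {a..b}"
        have "norm ((\<lambda>x. q n x - G x) x - (\<lambda>x. q n x - G x) a) \<le> e' * norm (x - a)"
        proof (rule differentiable_bound[where S = "{a..b}" and f' = "\<lambda>x h. h *\<^sub>R (f2 n x - F x)"])
          show "((\<lambda>x. q n x - G x) has_derivative (\<lambda>h. h *\<^sub>R (f2 n x - F x))) (at x within {a..b})"
            if "x \<in> {a..b}" for x
            using has_vector_derivative_diff[OF qd[OF that] G'[OF that]]
            unfolding has_vector_derivative_def .
          show "onorm (\<lambda>h. h *\<^sub>R (f2 n x - F x)) \<le> e'" if "x \<in> {a..b}" for x
          proof (rule onorm_bound)
            fix h :: real
            have "norm (f2 n x - F x) \<le> e'" using elim that by (auto simp: dist_norm less_imp_le)
            then show "norm (h *\<^sub>R (f2 n x - F x)) \<le> e' * norm h"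
              by (simp add: mult.commute[of e'] mult_left_mono)
          qed (use \<open>e' > 0\<close> in auto)
        qed (use x a in auto)
        also have "e' * norm (x - a) \<le> e' * (b - a)"
          using x \<open>e' > 0\<close> by (intro mult_left_mono) auto
        also have "\<dots> = e" using \<open>a < b\<close> by (simp add: e'_def)
        moreover have "G a = 0"
          using LIMSEQ_unique[OF G[OF a]] by (simp add: q_def)
        ultimately show "norm (q n x - G x) \<le> e" by (simp add: q_def)
      qed
    qed
  qed
  \<comment> \<open>The first-order Taylor remainder at \<open>a\<close>: it vanishes there and has
    derivative \<open>q n\<close>.\<close>
  define p where "p = (\<lambda>n x. f n x - f n a - (x - a) *\<^sub>R f1 n a)"
  have "\<exists>H. \<forall>x\<in>{a..b}. (\<lambda>n. p n x) \<longlonglongrightarrow> H x \<and>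
      (H has_derivative (\<lambda>h. h *\<^sub>R G x)) (at x within {a..b})"
  proof (rule has_derivative_sequence[where f' = "\<lambda>n x h. h *\<^sub>R q n x" and ?x0.0 = a and l = 0])
    show "(p n has_derivative (\<lambda>h. h *\<^sub>R q n x)) (at x within {a..b})"
      if "x \<in> {a..b}" for n x
    proof -
      have "(p n has_vector_derivative q n x) (at x within {a..b})"
        unfolding p_def q_def
        by (rule derivative_eq_intros d1 that refl | simp)+
      then show ?thesis unfolding has_vector_derivative_def .
    qed
    show "\<forall>\<^sub>F n in sequentially. \<forall>x\<in>{a..b}. \<forall>h. norm (h *\<^sub>R q n x - h *\<^sub>R G x) \<le> e * norm h"
      if "0 < e" for e
      using Gu[OF that]
    proof eventually_elim
      case (elim n)
      show ?case
      proof safe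
        fix x h assume "x \<in> {a..b}"
        then have "\<bar>h\<bar> * norm (q n x - G x) \<le> \<bar>h\<bar> * e" using elim by (intro mult_left_mono) auto
        then show "norm (h *\<^sub>R q n x - h *\<^sub>R G x) \<le> e * norm h"
          by (simp add: scaleR_right_diff_distrib[symmetric] mult.commute)
      qed
    qed
    show "(\<lambda>n. p n a) \<longlonglongrightarrow> 0" by (simp add: p_def)
  qed (use a in auto)
  then obtain H where H: "\<And>x. x \<in> {a..b} \<Longrightarrow> (\<lambda>n. p n x) \<longlonglongrightarrow> H x"
    and H': "\<And>x. x \<in> {a..b} \<Longrightarrow> (H has_vector_derivative G x) (at x within {a..b})"
    unfolding has_vector_derivative_def by blast
  \<comment> \<open>The limit of the slopes: \<open>p n b\<close> is solved for
    \<open>f1 n a\<close> and \<open>n\<close> sent to infinity.\<close>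
  define s where "s = (u b - u a - H b) /\<^sub>R (b - a)"
  have s: "(\<lambda>n. f1 n a) \<longlonglongrightarrow> s"
  proof -
    have "(\<lambda>n. (f n b - f n a - p n b) /\<^sub>R (b - a)) \<longlonglongrightarrow> s"
      unfolding s_def by (intro tendsto_intros lim0 H a b)
    then show ?thesis using \<open>a < b\<close> by (simp add: p_def)
  qed
  have u: "u x = u a + (x - a) *\<^sub>R s + H x" if "x \<in> {a..b}" for x
  proof -
    have "(\<lambda>n. f n a + (x - a) *\<^sub>R f1 n a + p n x) \<longlonglongrightarrow> u a + (x - a) *\<^sub>R s + H x"
      by (intro tendsto_intros lim0 H a that s)
    then have "(\<lambda>n. f n x) \<longlonglongrightarrow> u a + (x - a) *\<^sub>R s + H x" by (simp add: p_def)
    with lim0[OF that] show ?thesis by (rule LIMSEQ_unique)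
  qed
  show ?thesis
  proof (rule that[of "\<lambda>x. s + G x"])
    fix x assume x: "x \<in> {a..b}"
    show "(\<lambda>n. f1 n x) \<longlonglongrightarrow> s + G x"
      using tendsto_add[OF s G[OF x]] by (simp add: q_def)
    show "((\<lambda>x. s + G x) has_vector_derivative F x) (at x within {a..b})"
      by (rule derivative_eq_intros G' x refl | simp)+
    have "((\<lambda>x. u a + (x - a) *\<^sub>R s + H x) has_vector_derivative s + G x) (at x within {a..b})"
      by (rule derivative_eq_intros H' x refl | simp)+
    then show "(u has_vector_derivative s + G x) (at x within {a..b})"
      by (rule has_vector_derivative_transform[OF x, rotated]) (erule u)
  qed
qed

text \<open>Uniform convergence is at hand only on compact subintervals, but derivatives are local.
  Taking \<open>lim\<close> as the first derivative merges the functions found on the various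
  intervals into one on \<open>J\<close>.\<close>

lemma second_derivative_limit:
  fixes f f1 f2 :: "nat \<Rightarrow> real \<Rightarrow> complex"
  assumes J: "open J"
    and d1: "\<And>n x. x \<in> J \<Longrightarrow> (f n has_vector_derivative f1 n x) (at x)"
    and d2: "\<And>n x. x \<in> J \<Longrightarrow> (f1 n has_vector_derivative f2 n x) (at x)"
    and lim2: "\<And>a b. {a..b} \<subseteq> J \<Longrightarrow> uniform_limit {a..b} f2 F sequentially"
    and lim0: "\<And>x. x \<in> J \<Longrightarrow> (\<lambda>n. f n x) \<longlonglongrightarrow> u x"
  obtains u1 where "\<And>x. x \<in> J \<Longrightarrow> (\<lambda>n. f1 n x) \<longlonglongrightarrow> u1 x"
    and "\<And>x. x \<in> J \<Longrightarrow> (u has_vector_derivative u1 x) (at x)"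
    and "\<And>x. x \<in> J \<Longrightarrow> (u1 has_vector_derivative F x) (at x)"
proof (rule that[of "\<lambda>x. lim (\<lambda>n. f1 n x)"])
  fix x assume "x \<in> J"
  then obtain e where "e > 0" and e: "cball x e \<subseteq> J" using J open_contains_cball by blast
  define a b where "a = x - e" and "b = x + e"
  have "a < x" "x < b" "a < b" and ab: "{a..b} \<subseteq> J"
    using \<open>e > 0\<close> e by (auto simp: a_def b_def cball_eq_atLeastAtMost)
  obtain u1 where l: "\<And>x. x \<in> {a..b} \<Longrightarrow> (\<lambda>n. f1 n x) \<longlonglongrightarrow> u1 x"
    and u: "\<And>x. x \<in> {a..b} \<Longrightarrow> (u has_vector_derivative u1 x) (at x within {a..b})"
    and u1: "\<And>x. x \<in> {a..b} \<Longrightarrow> (u1 has_vector_derivative F x) (at x within {a..b})"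
  proof (rule second_derivative_limit_Icc[OF \<open>a < b\<close>])
    show "(f n has_vector_derivative f1 n x) (at x within {a..b})" if "x \<in> {a..b}" for n x
      by (rule has_vector_derivative_at_within[OF d1]) (use ab that in auto)
    show "(f1 n has_vector_derivative f2 n x) (at x within {a..b})" if "x \<in> {a..b}" for n x
      by (rule has_vector_derivative_at_within[OF d2]) (use ab that in auto)
    show "uniform_limit {a..b} f2 F sequentially" by (rule lim2[OF ab])
    show "(\<lambda>n. f n x) \<longlonglongrightarrow> u x" if "x \<in> {a..b}" for x
      using lim0 ab that by auto
  qed (rule that)
  have x: "x \<in> {a..b}" and nx: "at x within {a..b} = at x"
    using \<open>a < x\<close> \<open>x < b\<close> by (auto simp: at_within_Icc_at)
  have eq: "lim (\<lambda>n. f1 n y) = u1 y" if "y \<in> {a..b}" for y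
    using l[OF that] by (rule limI)
  show "(\<lambda>n. f1 n x) \<longlonglongrightarrow> lim (\<lambda>n. f1 n x)" using l[OF x] eq[OF x] by simp
  show "(u has_vector_derivative lim (\<lambda>n. f1 n x)) (at x)"
    using u[OF x] eq[OF x] nx by simp
  have "((\<lambda>x. lim (\<lambda>n. f1 n x)) has_vector_derivative F x) (at x within {a..b})"
    using u1[OF x] by (rule has_vector_derivative_transform[OF x, rotated]) (simp add: eq)
  then show "((\<lambda>x. lim (\<lambda>n. f1 n x)) has_vector_derivative F x) (at x)" using nx by simp
qed

lemma exponential_ode:
  fixes w :: "real \<Rightarrow> complex"
  assumes "open J" "is_interval J"
    and "\<And>x. x \<in> J \<Longrightarrow> (w has_vector_derivative a * w x) (at x)"
  obtains C where "\<And>x. x \<in> J \<Longrightarrow> w x = C * exp (a * of_real x)"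
proof -
  have e: "((\<lambda>x. exp (- a * of_real x)) has_vector_derivative - a * exp (- a * of_real x)) (at x)" for x
    by (rule has_vector_derivative_real_field) (rule derivative_eq_intros refl | simp)+
  have "((\<lambda>x. w x * exp (- a * of_real x)) has_vector_derivative 0) (at x within J)" if "x \<in> J" for x
    using has_vector_derivative_mult[OF assms(3)[OF that] e]
    by (simp add: algebra_simps has_vector_derivative_at_within)
  then obtain C where C: "\<And>x. x \<in> J \<Longrightarrow> w x * exp (- a * of_real x) = C"
    using has_vector_derivative_zero_constant[OF is_interval_convex[OF assms(2)]] by blast
  show ?thesis
  proof (rule that)
    fix x assume "x \<in> J"
    from C[OF this] show "w x = C * exp (a * of_real x)"
      by (simp add: exp_minus field_simps)
  qed
qed

section \<open>Completeness of the sine system for continuous functions\<close>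

text \<open>The identity 2 sin(ly) cos y = sin((l+1)y) + sin((l-1)y) trades a power of the cosine
  for a shift of the frequency, so the induction on \<open>j\<close> needs all \<open>l\<close> at
  once. Frequency 0 can occur and is harmless since its sine vanishes.\<close>

lemma sine_times_cos_power_integral_zero:
  fixes F :: "real \<Rightarrow> real"
  assumes cont: "continuous_on {0..pi} F"
    and zero: "\<And>l::nat. l \<ge> 1 \<Longrightarrow> integral {0..pi} (\<lambda>y. F y * sin (real l * y)) = 0"
  shows "integral {0..pi} (\<lambda>y. F y * sin (real l * y) * cos y ^ j) = 0"
proof (induction j arbitrary: l)
  case 0
  then show ?case using zero[of l] by (cases "l = 0") auto
next
  case (Suc j)
  show ?case
  proof (cases "l = 0")
    case False
    then have l: "real (l - 1) = real l - 1" by simp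
    have "integral {0..pi} (\<lambda>y. F y * sin (real l * y) * cos y ^ Suc j) =
      integral {0..pi} (\<lambda>y. (1/2) * (F y * sin (real (l + 1) * y) * cos y ^ j)
                          + (1/2) * (F y * sin (real (l - 1) * y) * cos y ^ j))"
    proof (rule integral_cong)
      fix y :: real
      have "sin (real (l + 1) * y) + sin (real (l - 1) * y) = 2 * (sin (real l * y) * cos y)"
        unfolding l by (simp add: algebra_simps sin_add sin_diff)
      then have "F y * sin (real l * y) * cos y ^ Suc j
        = (1/2) * F y * (sin (real (l + 1) * y) + sin (real (l - 1) * y)) * cos y ^ j"
        by simp
      then show "F y * sin (real l * y) * cos y ^ Suc j =
        (1/2) * (F y * sin (real (l + 1) * y) * cos y ^ j)
                          + (1/2) * (F y * sin (real (l - 1) * y) * cos y ^ j)"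
        by (simp only: algebra_simps)
    qed
    also have "\<dots> = (1/2) * integral {0..pi} (\<lambda>y. F y * sin (real (l + 1) * y) * cos y ^ j)
      + (1/2) * integral {0..pi} (\<lambda>y. F y * sin (real (l - 1) * y) * cos y ^ j)"
      by (subst integral_add)
        (auto intro!: integrable_continuous_real continuous_intros cont)
    finally show ?thesis by (simp only: Suc.IH)
  qed simp
qed

text \<open>With t = cos y, polynomials in t approximate \<open>F (arccos t)\<close> uniformly,
  while \<open>F y * sin y\<close> is orthogonal to every power of cos y. Hence the integral of F^2
  sin is at most \<open>e * M\<close> for every \<open>e > 0\<close> and vanishes. Its integrand is
  continuous and nonnegative, and the weight sin is positive inside the interval.\<close>

lemma sine_system_complete:
  fixes F :: "real \<Rightarrow> real"
  assumes cont: "continuous_on {0..pi} F"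
    and zero: "\<And>l::nat. l \<ge> 1 \<Longrightarrow> integral {0..pi} (\<lambda>y. F y * sin (real l * y)) = 0"
    and y: "y \<in> {0<..<pi}"
  shows "F y = 0"
proof -
  define M where "M = integral {0..pi} (\<lambda>y. \<bar>F y\<bar>)"
  have "M \<ge> 0" unfolding M_def by (intro integral_nonneg integrable_continuous_real continuous_intros cont) auto
  have bound: "\<bar>integral {0..pi} (\<lambda>y. F y * F y * sin y)\<bar> \<le> e * M" if "e > 0" for e
  proof -
    have "continuous_on {-1..1} (\<lambda>t. F (arccos t))"
      by (rule continuous_on_compose2[OF cont]) (auto intro!: continuous_intros arccos_lbound arccos_ubound)
    from Stone_Weierstrass_real_polynomial_function[OF compact_Icc this that]
    obtain P where P: "real_polynomial_function P"
      and Pe: "\<And>t. t \<in> {-1..1} \<Longrightarrow> \<bar>F (arccos t) - P t\<bar> < e"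
      by blast
    obtain a n where an: "P = (\<lambda>x. \<Sum>i\<le>n. a i * x ^ i)"
      using P real_polynomial_function_iff_sum by blast
    have contP: "continuous_on {0..pi} (\<lambda>y. P (cos y))" unfolding an by (intro continuous_intros)
    have "integral {0..pi} (\<lambda>y. F y * sin y * P (cos y))
      = integral {0..pi} (\<lambda>y. \<Sum>i\<le>n. a i * (F y * sin (real 1 * y) * cos y ^ i))"
      unfolding an by (rule integral_cong) (simp add: sum_distrib_left ac_simps)
    also have "\<dots> = (\<Sum>i\<le>n. a i * integral {0..pi} (\<lambda>y. F y * sin (real 1 * y) * cos y ^ i))"
      by (subst integral_sum)
        (auto intro!: integrable_continuous_real continuous_intros cont)
    also have "\<dots> = 0"
      using sine_times_cos_power_integral_zero[OF cont zero, of 1] by simp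
    finally have P0: "integral {0..pi} (\<lambda>y. F y * sin y * P (cos y)) = 0" .
    have "integral {0..pi} (\<lambda>y. F y * F y * sin y) =
       integral {0..pi} (\<lambda>y. F y * F y * sin y) - integral {0..pi} (\<lambda>y. F y * sin y * P (cos y))"
      using P0 by simp
    also have "\<dots> = integral {0..pi} (\<lambda>y. F y * F y * sin y - F y * sin y * P (cos y))"
      by (rule integral_diff[symmetric]) (auto intro!: integrable_continuous_real continuous_intros cont contP)
    finally have eq: "integral {0..pi} (\<lambda>y. F y * F y * sin y) = \<dots>" .
    have "norm (integral {0..pi} (\<lambda>y. F y * F y * sin y - F y * sin y * P (cos y)))
      \<le> integral {0..pi} (\<lambda>y. e * \<bar>F y\<bar>)"
    proof (rule integral_norm_bound_integral)
      fix y assume "y \<in> {0..pi}"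
      then have "\<bar>F y - P (cos y)\<bar> \<le> e" using Pe[of "cos y"] by (simp add: arccos_cos)
      then have "\<bar>sin y\<bar> * \<bar>F y - P (cos y)\<bar> \<le> 1 * e" by (intro mult_mono) auto
      then have "\<bar>F y\<bar> * (\<bar>sin y\<bar> * \<bar>F y - P (cos y)\<bar>) \<le> \<bar>F y\<bar> * e" by (intro mult_left_mono) auto
      moreover have "F y * F y * sin y - F y * sin y * P (cos y) = F y * (sin y * (F y - P (cos y)))"
        by (simp add: algebra_simps)
      ultimately show "norm (F y * F y * sin y - F y * sin y * P (cos y)) \<le> e * \<bar>F y\<bar>"
        by (simp add: abs_mult mult.commute)
    qed (auto intro!: integrable_continuous_real continuous_intros cont contP)
    then show ?thesis unfolding eq M_def by simp
  qed
  have "integral {0..pi} (\<lambda>y. F y * F y * sin y) = 0"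
  proof (rule ccontr)
    assume ne: "integral {0..pi} (\<lambda>y. F y * F y * sin y) \<noteq> 0" (is "?I \<noteq> 0")
    \<comment> \<open>This \<open>e\<close> makes \<open>e * M\<close> smaller than the absolute
      value of \<open>?I\<close>; \<open>M + 1\<close> keeps the denominator positive when
      \<open>M = 0\<close>.\<close>
    have "\<bar>?I\<bar> \<le> \<bar>?I\<bar> / (2 * (M + 1)) * M" using ne \<open>M \<ge> 0\<close> by (intro bound) auto
    also have "\<dots> < \<bar>?I\<bar>" 
    proof -
      have "M / (2 * (M + 1)) < 1" using \<open>M \<ge> 0\<close> by (simp add: divide_simps)
      then have "\<bar>?I\<bar> * (M / (2 * (M + 1))) < \<bar>?I\<bar> * 1"
        using ne by (intro mult_strict_left_mono) auto
      then show ?thesis by simp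
    qed
    finally show False by simp
  qed
  moreover have "continuous_on {0..pi} (\<lambda>y. F y * F y * sin y)"
    by (intro continuous_intros cont)
  moreover have "F y * F y * sin y \<ge> 0" if "y \<in> {0..pi}" for y
    using that by (auto simp: sin_ge_zero)
  ultimately have "\<forall>y\<in>{0..pi}. F y * F y * sin y = 0"
    using integral_eq_0_iff[of 0 pi "\<lambda>y. F y * F y * sin y"] by simp
  then show ?thesis using y sin_gt_zero[of y] by force
qed

subsection \<open>Traces in the space of square-integrable functions\<close>

lemma square_integrable_imp_integrable:
  assumes "square_integrable f"
  shows "integrable (lebesgue_on {0<..<pi}) f"
proof -
  interpret finite_measure "lebesgue_on {0<..<pi}" by (rule finite_measure_lebesgue_on) simp
  have "integrable (lebesgue_on {0<..<pi}) (\<lambda>y. 1 + (norm (f y))\<^sup>2)"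
    using assms unfolding square_integrable_def by simp
  then show ?thesis
  proof (rule Bochner_Integration.integrable_bound)
    show "f \<in> borel_measurable (lebesgue_on {0<..<pi})"
      using assms unfolding square_integrable_def by simp
    have "norm (f y) \<le> 1 + (norm (f y))\<^sup>2" for y
      using power2_less_eq_zero_iff[of "norm (f y) - 1"] zero_le_power2[of "norm (f y) - 1"]
      by (simp add: power2_eq_square algebra_simps) (smt (verit) norm_ge_zero mult_nonneg_nonneg)
    then show "AE y in lebesgue_on {0<..<pi}. norm (f y) \<le> norm (1 + (norm (f y))\<^sup>2)"
      by (smt (verit) eventually_at_top_dense always_eventually real_norm_def)
  qed
qed

lemma integrable_sine_mult:
  assumes "integrable (lebesgue_on {0<..<pi}) f"
  shows "integrable (lebesgue_on {0<..<pi}) (\<lambda>y. f y * complex_of_real (sin (real l * y)))"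
  using assms
proof (rule Bochner_Integration.integrable_bound)
  have "(\<lambda>y. complex_of_real (sin (real l * y))) \<in> borel_measurable (lebesgue_on {0<..<pi})"
    by (intro continuous_imp_measurable_on_sets_lebesgue continuous_intros) auto
  then show "(\<lambda>y. f y * complex_of_real (sin (real l * y))) \<in> borel_measurable (lebesgue_on {0<..<pi})"
    using assms by (intro borel_measurable_times) auto
  show "AE y in lebesgue_on {0<..<pi}. norm (f y * complex_of_real (sin (real l * y))) \<le> norm (f y)"
    by (intro always_eventually allI) (simp add: norm_mult mult_left_le)
qed

text \<open>Bridge between the gauge integral over the closed interval, used for sine coefficients,
  and the Lebesgue integral over the open one, used for traces.\<close>

lemma sine_coeff_lebesgue:
  assumes "integrable (lebesgue_on {0<..<pi}) f"
  shows "sine_coeff l f = complex_of_real (2 / pi) *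
    (LINT y|lebesgue_on {0<..<pi}. f y * complex_of_real (sin (real l * y)))"
  unfolding sine_coeff_def
  by (simp add: lebesgue_integral_eq_integral[OF integrable_sine_mult[OF assms]] integral_open_interval_real)

text \<open>A sine coefficient is a continuous functional on L^2. In place of the Cauchy-Schwarz
  inequality, the pointwise bound a \<le> e + a^2 / e is integrated over an interval of finite
  length: either a \<le> e, or a \<le> a^2 / e.\<close>

lemma L2_tendsto_sine_coeff:
  assumes "L2_tendsto f h F"
  shows "((\<lambda>x. sine_coeff l (f x)) \<longlongrightarrow> sine_coeff l h) F"
proof (rule tendstoI)
  fix d :: real assume "d > 0"
  define M where "M = lebesgue_on {0<..<pi}"
  \<comment> \<open>The final bound is 2/pi * (e * pi + e) \<le> 3 * e, which is below
    \<open>d\<close>.\<close>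
  define e where "e = d / 8"
  have "e > 0" using \<open>d > 0\<close> by (simp add: e_def)
  have h: "square_integrable h" and f: "\<forall>\<^sub>F x in F. square_integrable (f x)"
    and lim: "((\<lambda>x. LINT y|M. (norm (f x y - h y))\<^sup>2) \<longlongrightarrow> 0) F"
    using assms unfolding L2_tendsto_def M_def by auto
  have "\<forall>\<^sub>F x in F. dist (LINT y|M. (norm (f x y - h y))\<^sup>2) 0 < e * e"
    using lim \<open>e > 0\<close> by (intro tendstoD) auto
  with f show "\<forall>\<^sub>F x in F. dist (sine_coeff l (f x)) (sine_coeff l h) < d"
  proof eventually_elim
    case (elim x)
    let ?s = "\<lambda>y. complex_of_real (sin (real l * y))"
    note If = square_integrable_imp_integrable[OF elim(1)] and Ih = square_integrable_imp_integrable[OF h]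
    have I2: "integrable M (\<lambda>y. (norm (f x y - h y))\<^sup>2)"
    proof (rule Bochner_Integration.integrable_bound)
      show "integrable M (\<lambda>y. 2 * (norm (f x y))\<^sup>2 + 2 * (norm (h y))\<^sup>2)"
        using elim(1) h unfolding M_def square_integrable_def by auto
      show "(\<lambda>y. (norm (f x y - h y))\<^sup>2) \<in> borel_measurable M"
        using elim(1) h unfolding M_def square_integrable_def
        by (intro borel_measurable_power borel_measurable_norm borel_measurable_diff) auto
      have "(norm (a - b))\<^sup>2 \<le> 2 * (norm a)\<^sup>2 + 2 * (norm b)\<^sup>2" for a b :: complex
      proof -
        have "(norm (a - b))\<^sup>2 \<le> (norm a + norm b)\<^sup>2"
          by (intro power_mono norm_triangle_ineq4) auto
        also have "\<dots> \<le> 2 * (norm a)\<^sup>2 + 2 * (norm b)\<^sup>2"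
          using zero_le_power2[of "norm a - norm b"] by (simp add: power2_eq_square algebra_simps)
        finally show ?thesis .
      qed
      then show "AE y in M. norm ((norm (f x y - h y))\<^sup>2) \<le> norm (2 * (norm (f x y))\<^sup>2 + 2 * (norm (h y))\<^sup>2)"
        by (intro always_eventually allI) auto
    qed
    have I1: "integrable M (\<lambda>_. e)"
      unfolding M_def by (intro finite_measure.integrable_const finite_measure_lebesgue_on) simp
    have Is: "integrable M (\<lambda>y. (f x y - h y) * ?s y)"
      unfolding M_def by (intro integrable_sine_mult Bochner_Integration.integrable_diff If Ih)
    have "norm ((LINT y|M. f x y * ?s y) - (LINT y|M. h y * ?s y)) = norm (LINT y|M. (f x y - h y) * ?s y)"
      unfolding M_def by (simp add: left_diff_distrib Bochner_Integration.integral_diff integrable_sine_mult If Ih)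
    also have "\<dots> \<le> (LINT y|M. norm ((f x y - h y) * ?s y))" by (rule integral_norm_bound)
    also have "\<dots> \<le> (LINT y|M. e + (norm (f x y - h y))\<^sup>2 / e)"
    proof (rule integral_mono)
      show "integrable M (\<lambda>y. norm ((f x y - h y) * ?s y))" using Is by (rule integrable_norm)
      show "integrable M (\<lambda>y. e + (norm (f x y - h y))\<^sup>2 / e)" using I1 I2 by simp
      fix y
      have "a \<le> e + a\<^sup>2 / e" if "a \<ge> 0" for a
      proof (cases "a \<le> e")
        case True then show ?thesis using \<open>e > 0\<close> by (simp add: add_increasing2)
      next
        case False
        then have "a * e \<le> a * a" using that by (intro mult_left_mono) auto
        then have "a \<le> a\<^sup>2 / e" using \<open>e > 0\<close> by (simp add: field_simps power2_eq_square)
        then show ?thesis using \<open>e > 0\<close> by simp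
      qed
      then have "norm (f x y - h y) \<le> e + (norm (f x y - h y))\<^sup>2 / e" by simp
      moreover have "norm ((f x y - h y) * ?s y) \<le> norm (f x y - h y)"
        by (simp add: norm_mult mult_left_le)
      ultimately show "norm ((f x y - h y) * ?s y) \<le> e + (norm (f x y - h y))\<^sup>2 / e" by linarith
    qed
    also have "\<dots> = (LINT y|M. e) + (LINT y|M. (norm (f x y - h y))\<^sup>2) / e"
      using I1 I2 by simp
    also have "(LINT y|M. e) = e * pi"
      unfolding M_def by (simp add: measure_restrict_space)
    also have "(LINT y|M. (norm (f x y - h y))\<^sup>2) / e < e"
      using elim(2) \<open>e > 0\<close> by (simp add: divide_simps)
    finally have "norm ((LINT y|M. f x y * ?s y) - (LINT y|M. h y * ?s y)) < e * pi + e" by simp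
    then have "2 / pi * norm ((LINT y|M. f x y * ?s y) - (LINT y|M. h y * ?s y)) < 2 / pi * (e * pi + e)"
      by (intro mult_strict_left_mono) auto
    also have "\<dots> = 2 * e + 2 / pi * e" by (simp add: field_simps)
    also have "\<dots> \<le> 2 * e + 1 * e"
      using pi_ge_two \<open>e > 0\<close> by (intro add_left_mono mult_right_mono) auto
    also have "\<dots> < d" using \<open>d > 0\<close> by (simp add: e_def)
    finally have "2 / pi * norm ((LINT y|M. f x y * ?s y) - (LINT y|M. h y * ?s y)) < d" .
    moreover have "norm (complex_of_real (2 / pi)) = 2 / pi"
      by (simp only: norm_of_real) simp
    ultimately show ?case
      unfolding dist_norm sine_coeff_lebesgue[OF If] sine_coeff_lebesgue[OF Ih] M_def
        right_diff_distrib[symmetric] norm_mult by simp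
  qed
qed

subsection \<open>Modal equations on a strip\<close>

lemma uniform_limit_scalar:
  fixes A :: "nat \<Rightarrow> complex"
  assumes "A \<longlonglongrightarrow> B"
  shows "uniform_limit S (\<lambda>n x. A n) (\<lambda>x. B) sequentially"
  using assms by (auto simp: uniform_limit_iff tendsto_iff)

lemma continuous_slice:
  fixes f :: "'a::topological_space \<Rightarrow> 'b::topological_space \<Rightarrow> 'c::topological_space"
  assumes "continuous_on (J \<times> A) (\<lambda>(x, y). f x y)" "x \<in> J"
  shows "continuous_on A (f x)"
proof -
  have "continuous_on A (\<lambda>y. (x, y))"
    by (intro continuous_on_Pair continuous_on_const continuous_on_id)
  from continuous_on_compose2[OF assms(1) this] show ?thesis using assms(2) by auto
qed

text \<open>The equation V_xx = - c^2 (V_yy + k^2 V) with its derivatives as parameters, so that in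
  the layer they can be chain-rule expressions in the stretched variable. The continuity assumptions
  differ on purpose: closed cross-sections for \<open>V\<close>, open ones for the
  derivatives.\<close>

locale dirichlet_strip =
  fixes J :: "real set" and c :: complex and k :: real
    and V Vx Vy Vyy :: "real \<Rightarrow> real \<Rightarrow> complex"
  assumes open_J: "open J" and interval_J: "is_interval J"
    and cont_V: "continuous_on (J \<times> {0..pi}) (\<lambda>(x, y). V x y)"
    and cont_Vx: "continuous_on (J \<times> {0<..<pi}) (\<lambda>(x, y). Vx x y)"
    and cont_Vyy: "continuous_on (J \<times> {0<..<pi}) (\<lambda>(x, y). Vyy x y)"
    and V_x: "\<And>x y. x \<in> J \<Longrightarrow> y \<in> {0<..<pi} \<Longrightarrow>
      ((\<lambda>s. V s y) has_vector_derivative Vx x y) (at x)"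
    and V_xx: "\<And>x y. x \<in> J \<Longrightarrow> y \<in> {0<..<pi} \<Longrightarrow>
      ((\<lambda>s. Vx s y) has_vector_derivative - c\<^sup>2 * (Vyy x y + (complex_of_real k)\<^sup>2 * V x y)) (at x)"
    and V_y: "\<And>x y. x \<in> J \<Longrightarrow> y \<in> {0<..<pi} \<Longrightarrow>
      ((\<lambda>t. V x t) has_vector_derivative Vy x y) (at y)"
    and V_yy: "\<And>x y. x \<in> J \<Longrightarrow> y \<in> {0<..<pi} \<Longrightarrow>
      ((\<lambda>t. Vy x t) has_vector_derivative Vyy x y) (at y)"
    and V_boundary: "\<And>x. x \<in> J \<Longrightarrow> V x 0 = 0 \<and> V x pi = 0"
begin

text \<open>
  Only \<open>V\<close> is known to extend continuously to the sides \<open>y = 0\<close> and \<open>y = \<pi>\<close>. The affine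
  contraction \<open>inner n\<close> of \<open>[0, \<pi>]\<close> onto \<open>[\<epsilon>, \<pi> - \<epsilon>]\<close>, \<open>\<epsilon> = 1 / (n + 1)\<close>, allows integration by
  parts against \<open>sin (l y)\<close> with boundary terms that involve values of \<open>V\<close> only.
\<close>

definition margin :: "nat \<Rightarrow> real" where "margin n = inverse (real (Suc n))"
definition ratio :: "nat \<Rightarrow> real" where "ratio n = 1 - 2 * margin n / pi"
definition inner :: "nat \<Rightarrow> real \<Rightarrow> real" where "inner n y = ratio n * y + margin n"

lemma margin_bounds: "0 < margin n" "margin n \<le> 1"
  by (auto simp: margin_def field_simps)

lemma ratio_bounds: "0 < ratio n" "ratio n \<le> 1"
  using margin_bounds[of n] pi_gt3 by (auto simp: ratio_def field_simps)

lemma margin_tendsto: "margin \<longlonglongrightarrow> 0"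
  unfolding margin_def by (rule LIMSEQ_inverse_real_of_nat)

lemma ratio_tendsto: "ratio \<longlonglongrightarrow> 1"
proof -
  have "(\<lambda>n. 1 - 2 * margin n / pi) \<longlonglongrightarrow> 1 - 2 * 0 / pi"
    by (intro tendsto_intros margin_tendsto) auto
  then show ?thesis by (simp add: ratio_def[abs_def])
qed

lemma inner_pi: "inner n pi = pi - margin n"
  by (simp add: inner_def ratio_def field_simps)

lemma inner_bounds:
  assumes "y \<in> {0..pi}"
  shows "margin n \<le> inner n y" "inner n y \<le> pi - margin n"
proof -
  have "0 \<le> ratio n * y" and "ratio n * y \<le> ratio n * pi"
    using assms ratio_bounds[of n] by auto
  then show "margin n \<le> inner n y" "inner n y \<le> pi - margin n"
    by (auto simp: inner_def inner_pi[unfolded inner_def, symmetric])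
qed

lemma inner_in:
  assumes "y \<in> {0..pi}"
  shows "inner n y \<in> {0<..<pi}" "inner n y \<in> {0..pi}"
  using inner_bounds[OF assms, of n] margin_bounds[of n] by auto

lemma inner_dist:
  assumes "y \<in> {0..pi}"
  shows "\<bar>inner n y - y\<bar> \<le> margin n"
proof -
  have "0 \<le> 2 * margin n * y / pi" and "2 * margin n * y / pi \<le> 2 * margin n"
    using assms margin_bounds[of n] by (auto simp: field_simps)
  moreover have "inner n y - y = margin n - 2 * margin n * y / pi"
    by (simp add: inner_def ratio_def algebra_simps)
  ultimately show ?thesis by linarith
qed

text \<open>\<open>V\<close> is uniformly continuous on the compact rectangle, walls included, and
  \<open>inner n\<close> moves each point by at most \<open>margin n\<close>.\<close>

lemma V_inner_uniform:
  assumes "{a..b} \<subseteq> J" "e > 0"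
  shows "\<forall>\<^sub>F n in sequentially. \<forall>x\<in>{a..b}. \<forall>y\<in>{0..pi}. norm (V x (inner n y) - V x y) < e"
proof -
  have "uniformly_continuous_on ({a..b} \<times> {0..pi}) (\<lambda>(x, y). V x y)"
    by (intro compact_uniformly_continuous continuous_on_subset[OF cont_V] compact_Times)
      (use assms in auto)
  then obtain d where "d > 0" and d: "\<And>p q. p \<in> {a..b} \<times> {0..pi} \<Longrightarrow> q \<in> {a..b} \<times> {0..pi} \<Longrightarrow>
      dist q p < d \<Longrightarrow> dist ((\<lambda>(x, y). V x y) q) ((\<lambda>(x, y). V x y) p) < e"
    using \<open>e > 0\<close> unfolding uniformly_continuous_on_def by metis
  have "\<forall>\<^sub>F n in sequentially. dist (margin n) 0 < d"
    using margin_tendsto \<open>d > 0\<close> by (rule tendstoD)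
  then show ?thesis
  proof eventually_elim
    case (elim n)
    show ?case
    proof (intro ballI)
      fix x y assume x: "x \<in> {a..b}" and y: "y \<in> {0..pi}"
      have "dist (x, inner n y) (x, y) < d"
        using inner_dist[OF y, of n] elim margin_bounds[of n] by (simp add: dist_Pair_Pair dist_real_def)
      then show "norm (V x (inner n y) - V x y) < e"
        using d[of "(x, y)" "(x, inner n y)"] x y inner_in[OF y, of n] by (simp add: dist_norm)
    qed
  qed
qed

context
  fixes l :: nat
begin

abbreviation mode :: "real \<Rightarrow> complex" where "mode y \<equiv> complex_of_real (sin (real l * y))"

abbreviation comode :: "real \<Rightarrow> complex" where "comode y \<equiv> complex_of_real (cos (real l * y))"

definition moment :: "real \<Rightarrow> complex"
  where "moment x = integral {0..pi} (\<lambda>y. V x y * mode y)"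

text \<open>Only the argument of \<open>V\<close> is contracted. \<open>mode\<close> keeps the
  original variable and still vanishes at both endpoints, which removes the boundary terms
  containing \<open>Vy\<close>.\<close>

definition moment0 :: "nat \<Rightarrow> real \<Rightarrow> complex"
  where "moment0 n x = integral {0..pi} (\<lambda>y. V x (inner n y) * mode y)"

definition moment1 :: "nat \<Rightarrow> real \<Rightarrow> complex"
  where "moment1 n x = integral {0..pi} (\<lambda>y. Vx x (inner n y) * mode y)"

definition moment2 :: "nat \<Rightarrow> real \<Rightarrow> complex"
  where "moment2 n x = integral {0..pi} (\<lambda>y.
    - c\<^sup>2 * (Vyy x (inner n y) + (complex_of_real k)\<^sup>2 * V x (inner n y)) * mode y)"

lemma continuous_inner:
  assumes "continuous_on (J \<times> {0<..<pi}) (\<lambda>(x, y). f x y)"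
  shows "continuous_on (J \<times> {0..pi}) (\<lambda>(x, y). f x (inner n y))"
proof -
  have "continuous_on (J \<times> {0..pi}) (\<lambda>p. (\<lambda>(x, y). f x y) (fst p, inner n (snd p)))"
    by (rule continuous_on_compose2[OF assms])
      (auto simp: inner_def intro!: continuous_intros dest: inner_in[of _ n, unfolded inner_def])
  then show ?thesis by (simp add: case_prod_beta)
qed

lemma cont_V_open: "continuous_on (J \<times> {0<..<pi}) (\<lambda>(x, y). V x y)"
  by (rule continuous_on_subset[OF cont_V]) auto

lemma continuous_mode:
  assumes "continuous_on (J \<times> {0<..<pi}) (\<lambda>(x, y). f x y)"
  shows "continuous_on (J \<times> {0..pi}) (\<lambda>(x, y). f x (inner n y) * mode y)"
  using continuous_inner[OF assms, of n]
  by (auto simp: case_prod_beta intro!: continuous_intros)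

text \<open>After composition with \<open>inner n\<close> the integrands are continuous up to the
  endpoints, so differentiation under the integral sign is legitimate.\<close>

lemma moment0_deriv:
  assumes "x \<in> J"
  shows "(moment0 n has_vector_derivative moment1 n x) (at x)"
proof -
  have "((\<lambda>x. integral (cbox 0 pi) (\<lambda>y. V x (inner n y) * mode y)) has_vector_derivative
      integral (cbox 0 pi) (\<lambda>y. Vx x (inner n y) * mode y)) (at x within J)"
  proof (rule leibniz_rule_vector_derivative)
    show "((\<lambda>x. V x (inner n t) * mode t) has_vector_derivative Vx x (inner n t) * mode t) (at x within J)"
      if "x \<in> J" "t \<in> cbox 0 pi" for x t
      by (rule has_vector_derivative_mult_left[OF has_vector_derivative_at_within[OF V_x[OF _ inner_in(1)]]])
        (use that in auto)
    show "(\<lambda>y. V x (inner n y) * mode y) integrable_on cbox 0 pi" if "x \<in> J" for x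
      using continuous_slice[OF continuous_mode[OF cont_V_open] that]
      by (simp add: integrable_continuous_real)
    show "continuous_on (J \<times> cbox 0 pi) (\<lambda>(x, t). Vx x (inner n t) * mode t)"
      using continuous_mode[OF cont_Vx] by simp
  qed (use assms is_interval_convex[OF interval_J] in auto)
  then show ?thesis
    by (simp add: moment0_def[abs_def] moment1_def at_within_open[OF assms open_J])
qed

lemma cont_Vxx: "continuous_on (J \<times> {0<..<pi})
    (\<lambda>(x, y). - c\<^sup>2 * (Vyy x y + (complex_of_real k)\<^sup>2 * V x y))"
  using cont_V_open cont_Vyy by (auto simp: case_prod_beta intro!: continuous_intros)

lemma moment1_deriv:
  assumes "x \<in> J"
  shows "(moment1 n has_vector_derivative moment2 n x) (at x)"
proof -
  have "((\<lambda>x. integral (cbox 0 pi) (\<lambda>y. Vx x (inner n y) * mode y)) has_vector_derivative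
      integral (cbox 0 pi) (\<lambda>y. - c\<^sup>2 * (Vyy x (inner n y) + (complex_of_real k)\<^sup>2 * V x (inner n y)) * mode y))
      (at x within J)"
  proof (rule leibniz_rule_vector_derivative)
    show "((\<lambda>x. Vx x (inner n t) * mode t) has_vector_derivative
        - c\<^sup>2 * (Vyy x (inner n t) + (complex_of_real k)\<^sup>2 * V x (inner n t)) * mode t) (at x within J)"
      if "x \<in> J" "t \<in> cbox 0 pi" for x t
      by (rule has_vector_derivative_mult_left[OF has_vector_derivative_at_within[OF V_xx[OF _ inner_in(1)]]])
        (use that in auto)
    show "(\<lambda>y. Vx x (inner n y) * mode y) integrable_on cbox 0 pi" if "x \<in> J" for x
      using continuous_slice[OF continuous_mode[OF cont_Vx] that]
      by (simp add: integrable_continuous_real)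
    show "continuous_on (J \<times> cbox 0 pi)
        (\<lambda>(x, t). - c\<^sup>2 * (Vyy x (inner n t) + (complex_of_real k)\<^sup>2 * V x (inner n t)) * mode t)"
      using continuous_mode[OF cont_Vxx] by simp
  qed (use assms is_interval_convex[OF interval_J] in auto)
  then show ?thesis
    by (simp add: moment1_def[abs_def] moment2_def at_within_open[OF assms open_J])
qed

text \<open>Two integrations by parts in \<open>y\<close>. Each y-derivative of a contracted
  function carries a chain-rule factor \<open>t\<close>, whence the powers of
  \<open>1 / t\<close>.\<close>

lemma moment2_eq:
  fixes n :: nat
  assumes x: "x \<in> J"
  defines "t \<equiv> complex_of_real (ratio n)"
  shows "moment2 n x = c\<^sup>2 * ((of_nat l / t)\<^sup>2 - (complex_of_real k)\<^sup>2) * moment0 n x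
    + c\<^sup>2 * of_nat l / t\<^sup>2 * (comode pi * V x (inner n pi) - V x (inner n 0))"
proof -
  have t: "t \<noteq> 0" using ratio_bounds[of n] by (simp add: t_def)
  \<comment> \<open>The boundary expression of the two integrations by parts. In its derivative the
    products of \<open>Vy\<close> and \<open>comode\<close> cancel.\<close>
  define A where "A = (\<lambda>y. Vy x (inner n y) * mode y / t - of_nat l / t\<^sup>2 * (V x (inner n y) * comode y))"
  have inner_deriv: "(inner n has_real_derivative ratio n) (at y within S)" for y S
    unfolding inner_def[abs_def] by (rule derivative_eq_intros refl | simp)+
  have "((\<lambda>y. Vyy x (inner n y) * mode y + (of_nat l / t)\<^sup>2 * (V x (inner n y) * mode y))
      has_integral A pi - A 0) {0..pi}"
  proof (rule fundamental_theorem_of_calculus)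
    fix y assume y: "y \<in> {0..pi}"
    have 1: "((\<lambda>y. Vy x (inner n y)) has_vector_derivative t * Vyy x (inner n y)) (at y within {0..pi})"
      using vector_diff_chain_within[OF inner_deriv[of y "{0..pi}", unfolded has_real_derivative_iff_has_vector_derivative]
          has_vector_derivative_at_within[OF V_yy[OF x inner_in(1)[OF y]]]]
      by (simp add: o_def t_def scaleR_conv_of_real)
    have 2: "((\<lambda>y. V x (inner n y)) has_vector_derivative t * Vy x (inner n y)) (at y within {0..pi})"
      using vector_diff_chain_within[OF inner_deriv[of y "{0..pi}", unfolded has_real_derivative_iff_has_vector_derivative]
          has_vector_derivative_at_within[OF V_y[OF x inner_in(1)[OF y]]]]
      by (simp add: o_def t_def scaleR_conv_of_real)
    have 3: "(mode has_vector_derivative of_nat l * comode y) (at y within {0..pi})"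
      by (rule has_vector_derivative_eq_rhs[OF has_vector_derivative_of_real])
        (rule derivative_eq_intros refl | simp)+
    have 4: "(comode has_vector_derivative - of_nat l * mode y) (at y within {0..pi})"
      by (rule has_vector_derivative_eq_rhs[OF has_vector_derivative_of_real])
        (rule derivative_eq_intros refl | simp)+
    have "(A has_vector_derivative
        (Vy x (inner n y) * (of_nat l * comode y) + t * Vyy x (inner n y) * mode y) / t
        - of_nat l / t\<^sup>2 * (V x (inner n y) * (- of_nat l * mode y) + t * Vy x (inner n y) * comode y))
        (at y within {0..pi})"
      unfolding A_def
      by (intro has_vector_derivative_diff has_vector_derivative_divide has_vector_derivative_mult_right
          has_vector_derivative_mult 1 2 3 4)
    moreover have "(Vy x (inner n y) * (of_nat l * comode y) + t * Vyy x (inner n y) * mode y) / t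
        - of_nat l / t\<^sup>2 * (V x (inner n y) * (- of_nat l * mode y) + t * Vy x (inner n y) * comode y)
        = Vyy x (inner n y) * mode y + (of_nat l / t)\<^sup>2 * (V x (inner n y) * mode y)"
      using t by (simp add: field_simps power2_eq_square)
    ultimately show "(A has_vector_derivative
        Vyy x (inner n y) * mode y + (of_nat l / t)\<^sup>2 * (V x (inner n y) * mode y)) (at y within {0..pi})"
      by simp
  qed simp
  moreover have "A pi - A 0 = - (of_nat l / t\<^sup>2 * (comode pi * V x (inner n pi) - V x (inner n 0)))"
    by (simp add: A_def sin_npi algebra_simps)
  moreover have iV: "((\<lambda>y. V x (inner n y) * mode y) has_integral moment0 n x) {0..pi}"
    unfolding moment0_def
    using continuous_slice[OF continuous_mode[OF cont_V_open] x]
    by (intro integrable_integral integrable_continuous_real)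
  ultimately have "((\<lambda>y. - c\<^sup>2 * ((Vyy x (inner n y) * mode y + (of_nat l / t)\<^sup>2 * (V x (inner n y) * mode y))
      - ((of_nat l / t)\<^sup>2 - (complex_of_real k)\<^sup>2) * (V x (inner n y) * mode y))) has_integral
      - c\<^sup>2 * (- (of_nat l / t\<^sup>2 * (comode pi * V x (inner n pi) - V x (inner n 0)))
      - ((of_nat l / t)\<^sup>2 - (complex_of_real k)\<^sup>2) * moment0 n x)) {0..pi}"
    by (intro has_integral_mult_right has_integral_diff) auto
  from integral_unique[OF this] show ?thesis
    unfolding moment2_def by (simp add: algebra_simps)
qed

lemma moment0_uniform:
  assumes ab: "{a..b} \<subseteq> J"
  shows "uniform_limit {a..b} moment0 moment sequentially"
proof (rule uniform_limitI)
  fix e :: real assume "e > 0"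
  \<comment> \<open>The interval has length pi < 4, so an integrand bounded by \<open>e / 4\<close>
    integrates to less than \<open>e\<close>.\<close>
  then have "e / 4 > 0" by simp
  from V_inner_uniform[OF ab this]
  show "\<forall>\<^sub>F n in sequentially. \<forall>x\<in>{a..b}. dist (moment0 n x) (moment x) < e"
  proof eventually_elim
    case (elim n)
    show ?case
    proof
      fix x assume x: "x \<in> {a..b}"
      then have xJ: "x \<in> J" using ab by auto
      have i1: "(\<lambda>y. V x (inner n y) * mode y) integrable_on {0..pi}"
        using continuous_slice[OF continuous_mode[OF cont_V_open] xJ]
        by (simp add: integrable_continuous_real)
      have i2: "(\<lambda>y. V x y * mode y) integrable_on {0..pi}"
        by (intro integrable_continuous_real continuous_intros continuous_slice[OF cont_V xJ])
      have "norm (moment0 n x - moment x) = norm (integral {0..pi} (\<lambda>y. (V x (inner n y) - V x y) * mode y))"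
        unfolding moment0_def moment_def using i1 i2 by (simp add: left_diff_distrib integral_diff)
      also have "\<dots> \<le> integral {0..pi} (\<lambda>y. e / 4)"
      proof (rule integral_norm_bound_integral)
        show "(\<lambda>y. (V x (inner n y) - V x y) * mode y) integrable_on {0..pi}"
          using integrable_diff[OF i1 i2] by (simp add: left_diff_distrib)
        fix y assume y: "y \<in> {0..pi}"
        have "norm (V x (inner n y) - V x y) * norm (mode y) \<le> e / 4 * 1"
          using elim x y \<open>e > 0\<close> by (intro mult_mono) (auto simp: less_imp_le)
        then show "norm ((V x (inner n y) - V x y) * mode y) \<le> e / 4" by (simp add: norm_mult)
      qed (rule integrable_const_ivl)
      also have "\<dots> < e" using pi_less_4 \<open>e > 0\<close> by simp
      finally show "dist (moment0 n x) (moment x) < e" by (simp add: dist_norm)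
    qed
  qed
qed

lemma V_boundary_uniform:
  assumes ab: "{a..b} \<subseteq> J" and y: "y \<in> {0, pi}"
  shows "uniform_limit {a..b} (\<lambda>n x. V x (inner n y)) (\<lambda>x. 0) sequentially"
proof (rule uniform_limitI)
  fix e :: real assume "e > 0"
  from V_inner_uniform[OF ab this]
  show "\<forall>\<^sub>F n in sequentially. \<forall>x\<in>{a..b}. dist (V x (inner n y)) 0 < e"
  proof eventually_elim
    case (elim n)
    show ?case
    proof
      fix x assume x: "x \<in> {a..b}"
      have "V x y = 0" and "y \<in> {0..pi}" using V_boundary x ab y by auto
      with elim x show "dist (V x (inner n y)) 0 < e" by fastforce
    qed
  qed
qed

text \<open>In \<open>moment2_eq\<close> the ratio tends to 1 and the boundary values tend to the
  Dirichlet data, which are zero. What remains involves \<open>moment0\<close>, whose uniform limit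
  is known.\<close>

lemma moment2_uniform:
  assumes ab: "{a..b} \<subseteq> J"
  shows "uniform_limit {a..b} moment2
    (\<lambda>x. c\<^sup>2 * ((of_nat l)\<^sup>2 - (complex_of_real k)\<^sup>2) * moment x) sequentially"
proof -
  let ?t = "\<lambda>n. complex_of_real (ratio n)"
  have t: "?t \<longlonglongrightarrow> 1" using tendsto_of_real[OF ratio_tendsto, where 'a = complex] by simp
  have A: "(\<lambda>n. c\<^sup>2 * ((of_nat l / ?t n)\<^sup>2 - (complex_of_real k)\<^sup>2))
      \<longlonglongrightarrow> c\<^sup>2 * ((of_nat l / 1)\<^sup>2 - (complex_of_real k)\<^sup>2)"
    by (intro tendsto_intros t) simp
  have B: "(\<lambda>n. c\<^sup>2 * of_nat l / (?t n)\<^sup>2) \<longlonglongrightarrow> c\<^sup>2 * of_nat l / 1\<^sup>2"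
    by (intro tendsto_intros t) simp
  have "continuous_on {a..b} (\<lambda>x. integral (cbox 0 pi) (\<lambda>y. V x y * mode y))"
    by (rule integral_continuous_on_param)
      (use continuous_on_subset[OF cont_V, of "{a..b} \<times> {0..pi}"] ab in
        \<open>auto simp: case_prod_beta intro!: continuous_intros\<close>)
  then have "continuous_on {a..b} moment" by (simp add: moment_def[abs_def])
  \<comment> \<open>Products of uniform limits converge uniformly when the limits are
    bounded.\<close>
  then have bm: "bounded (moment ` {a..b})"
    by (intro compact_imp_bounded compact_continuous_image) auto
  have bc: "bounded ((\<lambda>x. z) ` {a..b})" for z :: complex
    by (rule bounded_subset[of "{z}"]) auto
  have "uniform_limit {a..b} (\<lambda>n x. c\<^sup>2 * ((of_nat l / ?t n)\<^sup>2 - (complex_of_real k)\<^sup>2) * moment0 n x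
      + c\<^sup>2 * of_nat l / (?t n)\<^sup>2 * (comode pi * V x (inner n pi) - V x (inner n 0)))
    (\<lambda>x. c\<^sup>2 * ((of_nat l / 1)\<^sup>2 - (complex_of_real k)\<^sup>2) * moment x
      + c\<^sup>2 * of_nat l / 1\<^sup>2 * (comode pi * 0 - 0)) sequentially"
    by (intro uniform_limit_add uniform_lim_mult uniform_limit_minus
        uniform_limit_scalar[OF A] uniform_limit_scalar[OF B] moment0_uniform[OF ab]
        V_boundary_uniform[OF ab] uniform_limit_const bm bc) auto
  then show ?thesis
    by (rule uniform_limit_cong'[THEN iffD1, rotated 2]) (use ab in \<open>auto simp: moment2_eq\<close>)
qed

lemma moment1_tendsto:
  assumes x: "x \<in> J" and Vx: "square_integrable (Vx x)"
  shows "(\<lambda>n. moment1 n x) \<longlonglongrightarrow> integral {0..pi} (\<lambda>y. Vx x y * mode y)"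
proof -
  \<comment> \<open>The integrand in the variable z, extended by zero to a common domain. At a fixed
    interior point the extension is eventually inactive.\<close>
  define h where "h = (\<lambda>n z. if z \<in> {margin n..pi - margin n}
    then Vx x z * mode ((z - margin n) / ratio n) else 0)"
  have sub: "{margin n..pi - margin n} \<subseteq> {0<..<pi}" for n using margin_bounds[of n] by auto
  have int: "(\<lambda>z. Vx x z * mode ((z - margin n) / ratio n)) integrable_on {margin n..pi - margin n}" for n
    using ratio_bounds[of n]
    by (intro integrable_continuous_real continuous_intros
        continuous_on_subset[OF continuous_slice[OF cont_Vx x] sub]) auto
  have hi: "(h n has_integral integral {margin n..pi - margin n} (\<lambda>z. Vx x z * mode ((z - margin n) / ratio n)))
      {0<..<pi}" for n
    unfolding h_def by (subst has_integral_restrict[OF sub]) (rule integrable_integral[OF int])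
  have aff: "((\<lambda>y. Vx x (inner n y) * mode y) has_integral
      integral {margin n..pi - margin n} (\<lambda>z. Vx x z * mode ((z - margin n) / ratio n)) /\<^sub>R ratio n) {0..pi}" for n
  proof -
    have "(pi - margin n - margin n) / ratio n = pi"
      using ratio_bounds[of n] by (simp add: ratio_def field_simps)
    moreover have cancel: "inverse (ratio n) * (ratio n * y) = y" for y
      using ratio_bounds[of n] by simp
    ultimately show ?thesis
      using has_integral_affinity'[OF integrable_integral[OF int[of n], folded box_real(2)], of "ratio n" "margin n"]
        ratio_bounds[of n]
      by (simp add: inner_def divide_inverse_commute cancel)
  qed
  have m1: "moment1 n x = integral {0<..<pi} (h n) /\<^sub>R ratio n" for n
    unfolding moment1_def integral_unique[OF hi] by (rule integral_unique[OF aff])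
  have "(\<lambda>n. integral {0<..<pi} (h n)) \<longlonglongrightarrow> integral {0<..<pi} (\<lambda>y. Vx x y * mode y)"
  proof (rule dominated_convergence)
    show "h n integrable_on {0<..<pi}" for n using hi by blast
    have "integrable (lebesgue_on {0<..<pi}) (\<lambda>y. norm (Vx x y))"
      by (intro integrable_norm square_integrable_imp_integrable[OF Vx])
    then show "(\<lambda>y. norm (Vx x y)) integrable_on {0<..<pi}"
      by (intro has_integral_integrable[OF has_integral_integral_lebesgue_on]) auto
    show "norm (h n y) \<le> norm (Vx x y)" for n y
      by (simp add: h_def norm_mult mult_left_le)
    fix y :: real assume y: "y \<in> {0<..<pi}"
    have "\<forall>\<^sub>F n in sequentially. margin n < min y (pi - y)"
      using margin_tendsto by (rule order_tendstoD) (use y in auto)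
    then have ev: "\<forall>\<^sub>F n in sequentially. Vx x y * mode ((y - margin n) / ratio n) = h n y"
      by eventually_elim (auto simp: h_def)
    have "(\<lambda>n. Vx x y * mode ((y - margin n) / ratio n)) \<longlonglongrightarrow> Vx x y * mode ((y - 0) / 1)"
      by (intro tendsto_intros margin_tendsto ratio_tendsto) simp
    then show "(\<lambda>n. h n y) \<longlonglongrightarrow> Vx x y * mode y"
      using Lim_transform_eventually[OF _ ev] by simp
  qed
  then have "(\<lambda>n. integral {0<..<pi} (h n) /\<^sub>R ratio n) \<longlonglongrightarrow> integral {0<..<pi} (\<lambda>y. Vx x y * mode y) /\<^sub>R 1"
    by (intro tendsto_intros ratio_tendsto) auto
  then show ?thesis by (simp add: m1 integral_open_interval_real)
qed

end

text \<open>The limit of the contracted moment equations. The last clause serves the transmission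
  condition: it is stated for single cross-sections because the flux traces give square
  integrability only near the interface.\<close>

proposition sine_coeff_ode:
  obtains m1 where "\<And>x. x \<in> J \<Longrightarrow> ((\<lambda>s. sine_coeff l (V s)) has_vector_derivative m1 x) (at x)"
    and "\<And>x. x \<in> J \<Longrightarrow> (m1 has_vector_derivative
      c\<^sup>2 * ((of_nat l)\<^sup>2 - (complex_of_real k)\<^sup>2) * sine_coeff l (V x)) (at x)"
    and "\<And>x. x \<in> J \<Longrightarrow> square_integrable (Vx x) \<Longrightarrow> m1 x = sine_coeff l (Vx x)"
proof -
  let ?c = "complex_of_real (2 / pi)"
  have lim0: "(\<lambda>n. moment0 l n x) \<longlonglongrightarrow> moment l x" if "x \<in> J" for x
    using tendsto_uniform_limitI[OF moment0_uniform[of x x l]] that by auto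
  obtain u1 where u1: "\<And>x. x \<in> J \<Longrightarrow> (\<lambda>n. moment1 l n x) \<longlonglongrightarrow> u1 x"
    and d1: "\<And>x. x \<in> J \<Longrightarrow> (moment l has_vector_derivative u1 x) (at x)"
    and d2: "\<And>x. x \<in> J \<Longrightarrow> (u1 has_vector_derivative
       c\<^sup>2 * ((of_nat l)\<^sup>2 - (complex_of_real k)\<^sup>2) * moment l x) (at x)"
    by (rule second_derivative_limit[OF open_J moment0_deriv moment1_deriv moment2_uniform lim0]) blast+
  have coeff: "sine_coeff l (V x) = ?c * moment l x" for x
    by (simp only: sine_coeff_def moment_def)
  show ?thesis
  proof (rule that[of "\<lambda>x. ?c * u1 x"])
    fix x assume x: "x \<in> J"
    show "((\<lambda>s. sine_coeff l (V s)) has_vector_derivative ?c * u1 x) (at x)"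
      unfolding coeff by (intro has_vector_derivative_mult_right d1 x)
    show "((\<lambda>x. ?c * u1 x) has_vector_derivative
      c\<^sup>2 * ((of_nat l)\<^sup>2 - (complex_of_real k)\<^sup>2) * sine_coeff l (V x)) (at x)"
      using has_vector_derivative_mult_right[OF d2[OF x], of ?c] unfolding coeff
      by (simp only: ac_simps)
    assume "square_integrable (Vx x)"
    from LIMSEQ_unique[OF u1[OF x] moment1_tendsto[OF x this]]
    show "?c * u1 x = sine_coeff l (Vx x)"
      by (simp only: sine_coeff_def)
  qed
qed

end

subsection \<open>The outgoing solution\<close>

text \<open>Factor m'' - a^2 m as (D + a)(D - a) m: the inner factor solves a first-order
  equation.\<close>

lemma second_order_factor:
  fixes m m1 :: "real \<Rightarrow> complex"
  assumes "open J" "is_interval J"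
    and "\<And>x. x \<in> J \<Longrightarrow> (m has_vector_derivative m1 x) (at x)"
    and "\<And>x. x \<in> J \<Longrightarrow> (m1 has_vector_derivative a\<^sup>2 * m x) (at x)"
  obtains C where "\<And>x. x \<in> J \<Longrightarrow> m1 x - a * m x = C * exp (- a * of_real x)"
proof -
  have "((\<lambda>x. m1 x - a * m x) has_vector_derivative - a * (m1 x - a * m x)) (at x)" if "x \<in> J" for x
    using has_vector_derivative_diff[OF assms(4)[OF that] has_vector_derivative_mult_right[OF assms(3)[OF that], of a]]
    by (simp add: algebra_simps power2_eq_square)
  from exponential_ode[OF assms(1,2) this] show ?thesis using that by blast
qed

lemma exp_decay_tendsto_0:
  assumes "Re a < 0"
  shows "((\<lambda>x. exp (a * complex_of_real x)) \<longlongrightarrow> 0) at_top"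
proof (rule tendsto_norm_zero_cancel)
  have "filterlim (\<lambda>x. Re a * x) at_bot at_top"
    by (rule filterlim_tendsto_neg_mult_at_bot[OF tendsto_const assms filterlim_ident])
  from filterlim_compose[OF exp_at_bot this]
  show "((\<lambda>x. norm (exp (a * complex_of_real x))) \<longlongrightarrow> 0) at_top" by simp
qed

text \<open>Factoring with \<open>a\<close> and with \<open>- a\<close> gives both m' - a m = C
  exp(-ax) and m' + a m = D exp(ax). Decay of \<open>m\<close> has to exclude the growing
  exponential, that is, force C = 0.\<close>

lemma decaying_solution:
  fixes m m1 :: "real \<Rightarrow> complex"
  assumes m: "\<And>x. x > 0 \<Longrightarrow> (m has_vector_derivative m1 x) (at x)"
    and m1: "\<And>x. x > 0 \<Longrightarrow> (m1 has_vector_derivative a\<^sup>2 * m x) (at x)"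
    and lim: "(m \<longlongrightarrow> 0) at_top"
    and a: "a = 0 \<or> Re a < 0"
    and "x > 0"
  shows "m1 x = a * m x"
proof -
  have J: "open {0::real<..}" "is_interval {0::real<..}" by auto
  obtain C where C: "\<And>x. x > 0 \<Longrightarrow> m1 x - a * m x = C * exp (- a * of_real x)"
    using second_order_factor[OF J, of m m1 a] m m1 by auto
  obtain D where D: "\<And>x. x > 0 \<Longrightarrow> m1 x - (- a) * m x = D * exp (- (- a) * of_real x)"
    using second_order_factor[OF J, of m m1 "- a"] m m1 by auto
  have "C = 0"
  proof (cases "a = 0")
    \<comment> \<open>Resonance: both factors coincide and \<open>m\<close> is affine with slope
      \<open>C\<close>. Its increments over unit steps equal \<open>C\<close> and tend to 0.\<close>
    case True
    have "((\<lambda>x. m x - of_real x * C) has_vector_derivative 0) (at x within {0<..})" if "x \<in> {0<..}" for x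
    proof -
      have "(m has_vector_derivative C) (at x)" using m[of x] C[of x] that True by simp
      then have "((\<lambda>x. m x - of_real x * C) has_vector_derivative C - 1 * C) (at x)"
        by (intro has_vector_derivative_diff has_vector_derivative_mult_left
            has_vector_derivative_real_field) (auto intro!: derivative_eq_intros)
      then show ?thesis by (simp add: has_vector_derivative_at_within)
    qed
    then obtain E where E: "\<And>x. x \<in> {0<..} \<Longrightarrow> m x - of_real x * C = E"
      using has_vector_derivative_zero_constant[OF is_interval_convex[OF J(2)]] by blast
    have "m (x + 1) - m x = C" if "x > 0" for x
      using E[of x] E[of "x + 1"] that by (simp add: algebra_simps)
    then have "\<forall>\<^sub>F x in at_top. m (x + 1) - m x = C"
      using eventually_gt_at_top[of 0] by (rule eventually_mono[rotated]) simp
    moreover have "((\<lambda>x. m (x + 1) - m x) \<longlongrightarrow> 0 - 0) at_top"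
      using filterlim_tendsto_add_at_top[OF tendsto_const filterlim_ident, of "1::real"]
      by (intro tendsto_diff lim filterlim_compose[OF lim]) (simp add: add.commute)
    ultimately have "((\<lambda>x::real. C) \<longlongrightarrow> 0 - 0) at_top"
      using tendsto_cong by fast
    then show ?thesis by (simp add: tendsto_const_iff)
  next
    case False
    then have e: "((\<lambda>x. exp (a * complex_of_real x)) \<longlongrightarrow> 0) at_top"
      using a exp_decay_tendsto_0 by simp
    \<comment> \<open>Subtracting the two identities eliminates m'; multiplication by exp(ax) then
      isolates \<open>C\<close>.\<close>
    have "((\<lambda>x. (D * exp (a * of_real x) - 2 * a * m x) * exp (a * of_real x)) \<longlongrightarrow> (D * 0 - 2 * a * 0) * 0) at_top"
      by (intro tendsto_intros e lim)
    moreover have "\<forall>\<^sub>F x in at_top. (D * exp (a * of_real x) - 2 * a * m x) * exp (a * of_real x) = C"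
      using eventually_gt_at_top[of 0]
    proof eventually_elim
      case (elim x)
      have "D * exp (a * of_real x) - 2 * a * m x = C * exp (- a * of_real x)"
        using C[OF elim] D[OF elim] by (simp add: algebra_simps)
      then show ?case by (simp add: exp_minus)
    qed
    ultimately have "((\<lambda>x::real. C) \<longlongrightarrow> 0) at_top"
      using tendsto_cong by force
    then show ?thesis by (simp add: tendsto_const_iff)
  qed
  then show ?thesis using C[OF \<open>x > 0\<close>] by simp
qed

lemma first_order_from_trace:
  fixes m :: "real \<Rightarrow> complex"
  assumes "0 < b"
    and m: "\<And>x. x \<in> {0<..<b} \<Longrightarrow> (m has_vector_derivative a * m x) (at x)"
    and lim: "(m \<longlongrightarrow> m0) (at_right 0)"
    and x: "x \<in> {0<..<b}"
  shows "m x = m0 * exp (a * of_real x)"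
proof -
  obtain A where A: "\<And>x. x \<in> {0<..<b} \<Longrightarrow> m x = A * exp (a * of_real x)"
    using exponential_ode[of "{0<..<b}" m a] m by (auto simp: is_interval_oo)
  have "((\<lambda>x. A * exp (a * of_real x)) \<longlongrightarrow> A * exp (a * of_real 0)) (at_right 0)"
    by (intro tendsto_intros)
  moreover have "\<forall>\<^sub>F x in at_right 0. A * exp (a * of_real x) = m x"
    using eventually_at_right_real[OF \<open>0 < b\<close>] by eventually_elim (simp add: A)
  ultimately have "(m \<longlongrightarrow> A) (at_right 0)"
    using Lim_transform_eventually by force
  then have "A = m0" using lim by (rule tendsto_unique[rotated]) simp
  then show ?thesis using A[OF x] by simp
qed

lemma C1_on_derivs:
  assumes "C1_on D f" "(x, y) \<in> D"
  shows "((\<lambda>s. f s y) has_vector_derivative pdx f x y) (at x)"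
    and "((\<lambda>t. f x t) has_vector_derivative pdy f x y) (at y)"
  using assms unfolding C1_on_def pdx_def pdy_def
  by (auto simp: vector_derivative_works[symmetric])

lemma C2_on_derivs:
  assumes "C2_on D f" "(x, y) \<in> D"
  shows "((\<lambda>s. f s y) has_vector_derivative pdx f x y) (at x)"
    and "((\<lambda>s. pdx f s y) has_vector_derivative pdx (pdx f) x y) (at x)"
    and "((\<lambda>t. f x t) has_vector_derivative pdy f x y) (at y)"
    and "((\<lambda>t. pdy f x t) has_vector_derivative pdy (pdy f) x y) (at y)"
  using assms unfolding C2_on_def by (auto intro: C1_on_derivs)

lemma C2_on_continuous:
  assumes "C2_on D f"
  shows "continuous_on D (\<lambda>(x, y). pdx f x y)" "continuous_on D (\<lambda>(x, y). pdy (pdy f) x y)"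
  using assms unfolding C2_on_def C1_on_def by auto

lemma khat_power2: "(khat k l)\<^sup>2 = (complex_of_real k)\<^sup>2 - (of_nat l)\<^sup>2"
  by (simp add: khat_def)

text \<open>Resonant, propagating and evanescent modes.\<close>

lemma khat_cases:
  obtains "khat k l = 0" | p where "p > 0" "khat k l = complex_of_real p"
  | q where "q > 0" "khat k l = \<i> * complex_of_real q"
proof -
  consider "k\<^sup>2 - (real l)\<^sup>2 = 0" | "k\<^sup>2 - (real l)\<^sup>2 > 0" | "k\<^sup>2 - (real l)\<^sup>2 < 0" by linarith
  then show ?thesis
  proof cases
    case 1 then show ?thesis using that(1) by (simp add: khat_def)
  next
    case 2
    then show ?thesis using that(2)[of "sqrt (k\<^sup>2 - (real l)\<^sup>2)"]
      by (simp add: khat_def csqrt_of_real_nonneg del: of_real_diff)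
  next
    case 3
    then show ?thesis using that(3)[of "sqrt \<bar>k\<^sup>2 - (real l)\<^sup>2\<bar>"]
      by (simp add: khat_def csqrt_of_real_nonpos del: of_real_diff)
  qed
qed

lemma Im_khat_nonneg: "Im (khat k l) \<ge> 0"
  by (rule khat_cases[of k l]) auto

text \<open>For a propagating mode with wave number p the real part is
  \<open>- \<sigma> * p\<close>; for an evanescent one with rate q it is
  \<open>- \<sigma>1 * q\<close>. Each stretching parameter damps one of the two kinds.\<close>

lemma compressed_khat_decay:
  assumes "\<sigma>1 > 0" "\<sigma> > 0"
  defines "c \<equiv> complex_of_real \<sigma>1 + \<i> * complex_of_real \<sigma>"
  shows "\<i> * c * khat k l = 0 \<or> Re (\<i> * c * khat k l) < 0"
  by (rule khat_cases[of k l]) (use assms in \<open>auto simp: c_def\<close>)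

text \<open>The radiation condition says that the inner factor m' - a m tends to 0. By
  \<open>second_order_factor\<close> it is \<open>C\<close> times an exponential that does not
  decay, so it vanishes identically.\<close>

lemma waveguide_sine_coeff:
  assumes U: "waveguide_solution k g U" and l: "l \<ge> 1" and x: "x > 0"
  shows "sine_coeff l (U x) = sine_coeff l g * exp (\<i> * khat k l * of_real x)"
proof -
  let ?a = "\<i> * khat k l"
  have C2: "C2_on ({0<..} \<times> {0<..<pi}) U"
    and cont: "continuous_on ({0<..} \<times> {0..pi}) (\<lambda>(x, y). U x y)"
    and pde: "\<And>x y. x \<in> {0<..} \<Longrightarrow> y \<in> {0<..<pi} \<Longrightarrow>
       pdx (pdx U) x y + pdy (pdy U) x y + (complex_of_real k)\<^sup>2 * U x y = 0"
    and bd: "\<And>x. x \<in> {0<..} \<Longrightarrow> U x 0 = 0 \<and> U x pi = 0"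
    and g: "L2_tendsto U g (at_right 0)" and out: "outgoing k U"
    using U unfolding waveguide_solution_def by auto
  interpret dirichlet_strip "{0<..}" 1 k U "pdx U" "pdy U" "pdy (pdy U)"
  proof
    fix x y :: real assume xy: "x \<in> {0<..}" "y \<in> {0<..<pi}"
    then have D: "(x, y) \<in> {0<..} \<times> {0<..<pi}" by simp
    show "((\<lambda>s. U s y) has_vector_derivative pdx U x y) (at x)"
      and "((\<lambda>t. U x t) has_vector_derivative pdy U x y) (at y)"
      and "((\<lambda>t. pdy U x t) has_vector_derivative pdy (pdy U) x y) (at y)"
      using C2_on_derivs[OF C2 D] by auto
    have "pdx (pdx U) x y = - 1\<^sup>2 * (pdy (pdy U) x y + (complex_of_real k)\<^sup>2 * U x y)"
      using pde[OF xy] by (simp add: algebra_simps add_eq_0_iff)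
    then show "((\<lambda>s. pdx U s y) has_vector_derivative
        - 1\<^sup>2 * (pdy (pdy U) x y + (complex_of_real k)\<^sup>2 * U x y)) (at x)"
      using C2_on_derivs(2)[OF C2 D] by simp
  qed (use C2_on_continuous[OF C2] cont bd in auto)
  obtain m1 where m: "\<And>x. x \<in> {0<..} \<Longrightarrow> ((\<lambda>s. sine_coeff l (U s)) has_vector_derivative m1 x) (at x)"
    and m1: "\<And>x. x \<in> {0<..} \<Longrightarrow> (m1 has_vector_derivative
      1\<^sup>2 * ((of_nat l)\<^sup>2 - (complex_of_real k)\<^sup>2) * sine_coeff l (U x)) (at x)"
    by (rule sine_coeff_ode) blast
  have a2: "?a\<^sup>2 = 1\<^sup>2 * ((of_nat l)\<^sup>2 - (complex_of_real k)\<^sup>2)"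
    by (simp add: power_mult_distrib khat_power2)
  obtain C where C: "\<And>x. x \<in> {0<..} \<Longrightarrow> m1 x - ?a * sine_coeff l (U x) = C * exp (- ?a * of_real x)"
    by (rule second_order_factor[OF open_J interval_J m m1[folded a2]]) blast+
  have "((\<lambda>x. vector_derivative (\<lambda>s. sine_coeff l (U s)) (at x) - ?a * sine_coeff l (U x)) \<longlongrightarrow> 0) at_top"
    using out l unfolding outgoing_def by blast
  moreover have "\<forall>\<^sub>F x in at_top. vector_derivative (\<lambda>s. sine_coeff l (U s)) (at x) - ?a * sine_coeff l (U x)
      = C * exp (- ?a * of_real x)"
    using eventually_gt_at_top[of 0] by eventually_elim (use C in \<open>simp add: vector_derivative_at[OF m]\<close>)
  ultimately have "((\<lambda>x. C * exp (- ?a * of_real x)) \<longlongrightarrow> 0) at_top"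
    by (rule Lim_transform_eventually)
  then have "((\<lambda>x. norm (C * exp (- ?a * of_real x))) \<longlongrightarrow> 0) at_top"
    by (rule tendsto_norm_zero)
  \<comment> \<open>The exponential has modulus exp(x Im \<open>khat k l\<close>) \<ge> 1, which
    treats all kinds of modes at once.\<close>
  moreover have "\<forall>\<^sub>F x in at_top. norm C \<le> norm (C * exp (- ?a * of_real x))"
    using eventually_gt_at_top[of "0::real"]
    by eventually_elim (simp add: norm_mult mult_le_cancel_left1 Im_khat_nonneg)
  ultimately have "norm C \<le> 0"
    by (rule tendsto_lowerbound) simp
  then have "m1 x = ?a * sine_coeff l (U x)" if "x \<in> {0<..}" for x using C[OF that] by simp
  then have "((\<lambda>s. sine_coeff l (U s)) has_vector_derivative ?a * sine_coeff l (U z)) (at z)"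
    if "z \<in> {0<..<x + 1}" for z using m[of z] that by auto
  then show ?thesis
    by (rule first_order_from_trace[where b = "x + 1", rotated]) (use x L2_tendsto_sine_coeff[OF g] in auto)
qed

subsection \<open>The layer\<close>

lemma square_integrable_scale:
  assumes "square_integrable f"
  shows "square_integrable (\<lambda>y. a * f y)"
  using assms unfolding square_integrable_def
  by (auto simp: norm_mult power_mult_distrib)

lemma sine_coeff_scale: "sine_coeff l (\<lambda>y. a * f y) = a * sine_coeff l f"
  unfolding sine_coeff_def by (simp add: mult.assoc)

locale layer =
  fixes k L d \<sigma>\<^sub>0 \<sigma>\<^sub>1 :: real
  assumes k: "k > 0" and L: "L > 0" and d: "d > 0" and \<sigma>\<^sub>0: "\<sigma>\<^sub>0 > 0" and \<sigma>\<^sub>1: "\<sigma>\<^sub>1 > 0"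
begin

text \<open>The slope of \<open>pal_S\<close> in the layer as an affine function of
  \<open>pal_rho\<close>.\<close>

definition speed :: complex
  where "speed = complex_of_real \<sigma>\<^sub>1 + \<i> * complex_of_real (\<sigma>\<^sub>0 / k)"

text \<open>Inverse of \<open>x \<mapsto> pal_rho L d x - L\<close>, which maps the layer \<open>(L, L + d)\<close> onto \<open>(0, \<infinity>)\<close>.\<close>

definition decompress :: "real \<Rightarrow> real"
  where "decompress r = L + d * r / (d + r)"

definition decompress' :: "real \<Rightarrow> real"
  where "decompress' r = d\<^sup>2 / (d + r)\<^sup>2"

abbreviation S' :: "real \<Rightarrow> complex" where "S' \<equiv> pal_S' k L d \<sigma>\<^sub>0 \<sigma>\<^sub>1"

lemma speed_nonzero: "speed \<noteq> 0"
  using \<sigma>\<^sub>1 by (auto simp: speed_def complex_eq_iff)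

lemma S'_inner:
  assumes "x < L"
  shows "S' x = 1"
proof -
  have "(complex_of_real has_vector_derivative 1) (at x)"
    by (rule has_vector_derivative_eq_rhs[OF has_vector_derivative_of_real])
      (rule derivative_eq_intros refl | simp)+
  then have "(pal_S k L d \<sigma>\<^sub>0 \<sigma>\<^sub>1 has_vector_derivative 1) (at x)"
    by (rule has_vector_derivative_transform_within_open[where S = "{..<L}"])
      (use assms in \<open>auto simp: pal_S_def\<close>)
  then show ?thesis unfolding pal_S'_def by (rule vector_derivative_at)
qed

lemma S'_layer:
  assumes x: "x \<in> {L<..<L + d}"
  shows "S' x = speed * complex_of_real (d\<^sup>2 / (L + d - x)\<^sup>2)"
proof -
  have rho: "(pal_rho L d has_real_derivative d\<^sup>2 / (L + d - x)\<^sup>2) (at x)"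
    unfolding pal_rho_def[abs_def]
    by (rule derivative_eq_intros refl | use x in \<open>simp; fail\<close>)+
      (use x in \<open>simp add: field_simps power2_eq_square\<close>)
  have "((\<lambda>x. complex_of_real (\<sigma>\<^sub>1 * pal_rho L d x)
      + \<i> * complex_of_real (\<sigma>\<^sub>0 / k) * complex_of_real (pal_rho L d x - L))
      has_vector_derivative
      complex_of_real (\<sigma>\<^sub>1 * (d\<^sup>2 / (L + d - x)\<^sup>2))
      + \<i> * complex_of_real (\<sigma>\<^sub>0 / k) * complex_of_real (d\<^sup>2 / (L + d - x)\<^sup>2 - 0)) (at x)"
    by (intro has_vector_derivative_add has_vector_derivative_mult_right has_vector_derivative_of_real
        DERIV_cmult rho DERIV_diff DERIV_const)
  then have "(pal_S k L d \<sigma>\<^sub>0 \<sigma>\<^sub>1 has_vector_derivative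
      complex_of_real (\<sigma>\<^sub>1 * (d\<^sup>2 / (L + d - x)\<^sup>2))
      + \<i> * complex_of_real (\<sigma>\<^sub>0 / k) * complex_of_real (d\<^sup>2 / (L + d - x)\<^sup>2 - 0)) (at x)"
    by (rule has_vector_derivative_transform_within_open[where S = "{L<..}"])
      (use x in \<open>auto simp: pal_S_def\<close>)
  then have "S' x = complex_of_real (\<sigma>\<^sub>1 * (d\<^sup>2 / (L + d - x)\<^sup>2))
      + \<i> * complex_of_real (\<sigma>\<^sub>0 / k) * complex_of_real (d\<^sup>2 / (L + d - x)\<^sup>2 - 0)"
    unfolding pal_S'_def by (rule vector_derivative_at)
  then show ?thesis by (simp only: speed_def of_real_mult distrib_right diff_zero mult.assoc)
qed

lemma decompress_in:
  assumes "r > 0"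
  shows "decompress r \<in> {L<..<L + d}"
  using assms d by (auto simp: decompress_def field_simps)

text \<open>The slope of \<open>pal_rho\<close> is the reciprocal of the slope of its inverse. It
  follows that \<open>1 / S'\<close> times d/dx is \<open>1 / speed\<close> times d/dr: the
  stretched variable has constant coefficients.\<close>

lemma S'_decompress:
  assumes "r > 0"
  shows "S' (decompress r) = speed / complex_of_real (decompress' r)"
proof -
  have "L + d - decompress r = d\<^sup>2 / (d + r)"
    using assms d by (simp add: decompress_def field_simps power2_eq_square)
  then have "d\<^sup>2 / (L + d - decompress r)\<^sup>2 = inverse (decompress' r)"
    using assms d by (simp only: decompress'_def) (simp add: power2_eq_square)
  then show ?thesis
    unfolding S'_layer[OF decompress_in[OF assms]] by (simp add: divide_inverse)
qed

lemma decompress'_pos: "r > 0 \<Longrightarrow> decompress' r > 0"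
  using d by (simp add: decompress'_def)

lemma decompress_deriv:
  assumes "r > 0"
  shows "(decompress has_vector_derivative decompress' r) (at r)"
  unfolding has_real_derivative_iff_has_vector_derivative[symmetric] decompress_def[abs_def] decompress'_def
  by (rule derivative_eq_intros refl | use assms d in \<open>simp; fail\<close>)+
    (use assms d in \<open>simp add: field_simps power2_eq_square\<close>)

lemma decompress_at_right: "filterlim decompress (at_right L) (at_right 0)"
proof -
  have "(decompress \<longlongrightarrow> L + d * 0 / (d + 0)) (at_right 0)"
    unfolding decompress_def[abs_def] using d by (intro tendsto_intros) auto
  moreover have "\<forall>\<^sub>F r in at_right 0. decompress r \<in> {L<..}"
    using eventually_at_right_less[of 0] by eventually_elim (use decompress_in in auto)
  ultimately show ?thesis
    unfolding filterlim_at by (auto elim!: eventually_mono)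
qed

text \<open>This turns the Dirichlet condition at the outer end into decay at infinity. The limit is
  visible after writing d r / (d + r) as d - d^2 / (d + r).\<close>

lemma decompress_at_top: "filterlim decompress (at_left (L + d)) at_top"
proof -
  have "((\<lambda>r. L + d - d\<^sup>2 / (d + r)) \<longlongrightarrow> L + d - 0) at_top"
    by (intro tendsto_intros tendsto_divide_0[OF tendsto_const] filterlim_at_top_imp_at_infinity
        filterlim_tendsto_add_at_top[OF tendsto_const] filterlim_ident)
  moreover have "\<forall>\<^sub>F r in at_top. L + d - d\<^sup>2 / (d + r) = decompress r"
    using eventually_gt_at_top[of "0::real"]
    by eventually_elim (use d in \<open>simp add: decompress_def field_simps power2_eq_square\<close>)
  ultimately have "(decompress \<longlongrightarrow> L + d) at_top"
    using Lim_transform_eventually by force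
  moreover have "\<forall>\<^sub>F r in at_top. decompress r \<in> {..<L + d}"
    using eventually_gt_at_top[of "0::real"] by eventually_elim (use decompress_in in auto)
  ultimately show ?thesis
    unfolding filterlim_at by (auto elim!: eventually_mono)
qed

lemma pal_sine_coeff:
  assumes U: "pal_solution k L d \<sigma>\<^sub>0 \<sigma>\<^sub>1 g U" and x: "x \<in> {0<..<L}"
  shows "sine_coeff l (U x) = sine_coeff l g * exp (\<i> * khat k l * of_real x)"
proof -
  define I where "I = {0<..<L} \<union> {L<..<L + d}"
  define P where "P = (\<lambda>s t. 1 / S' s * pdx U s t)"
  obtain h v where C2: "C2_on (I \<times> {0<..<pi}) U"
    and cont: "continuous_on (I \<times> {0..pi}) (\<lambda>(x, y). U x y)"
    and pde: "\<And>x y. x \<in> I \<Longrightarrow> y \<in> {0<..<pi} \<Longrightarrow>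
         pdx P x y + pdy (\<lambda>s t. S' s * pdy U s t) x y + (complex_of_real k)\<^sup>2 * S' x * U x y = 0"
    and hl: "L2_tendsto U h (at_left L)" and hr: "L2_tendsto U h (at_right L)"
    and vl: "L2_tendsto (pdx U) v (at_left L)" and vr: "L2_tendsto P v (at_right L)"
    and bd: "\<And>x. x \<in> I \<Longrightarrow> U x 0 = 0 \<and> U x pi = 0"
    and g: "L2_tendsto U g (at_right 0)" and end0: "L2_tendsto U (\<lambda>_. 0) (at_left (L + d))"
    using U unfolding pal_solution_def Let_def I_def P_def by auto
  have pdy_flux: "pdy (\<lambda>s t. S' s * pdy U s t) x y = S' x * pdy (pdy U) x y"
    if "x \<in> I" "y \<in> {0<..<pi}" for x y
    unfolding pdy_def[of "\<lambda>s t. S' s * pdy U s t"]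
    by (intro vector_derivative_at has_vector_derivative_mult_right C2_on_derivs(4)[OF C2])
      (use that in auto)
  let ?a = "\<i> * khat k l" and ?b = "\<i> * speed * khat k l"
  have a2: "?a\<^sup>2 = 1\<^sup>2 * ((of_nat l)\<^sup>2 - (complex_of_real k)\<^sup>2)"
    by (simp add: power_mult_distrib khat_power2)
  have b2: "?b\<^sup>2 = speed\<^sup>2 * ((of_nat l)\<^sup>2 - (complex_of_real k)\<^sup>2)"
    by (simp add: power_mult_distrib khat_power2 algebra_simps)

  interpret left: dirichlet_strip "{0<..<L}" 1 k U "pdx U" "pdy U" "pdy (pdy U)"
  proof
    fix x y :: real assume xy: "x \<in> {0<..<L}" "y \<in> {0<..<pi}"
    then have D: "(x, y) \<in> I \<times> {0<..<pi}" by (simp add: I_def)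
    show "((\<lambda>s. U s y) has_vector_derivative pdx U x y) (at x)"
      and "((\<lambda>t. U x t) has_vector_derivative pdy U x y) (at y)"
      and "((\<lambda>t. pdy U x t) has_vector_derivative pdy (pdy U) x y) (at y)"
      using C2_on_derivs[OF C2 D] by auto
    have "((\<lambda>s. P s y) has_vector_derivative pdx (pdx U) x y) (at x)"
      by (rule has_vector_derivative_transform_within_open[OF C2_on_derivs(2)[OF C2 D], of "{..<L}"])
        (use xy in \<open>auto simp: P_def S'_inner\<close>)
    then have "pdx P x y = pdx (pdx U) x y" unfolding pdx_def[of P] by (rule vector_derivative_at)
    then have "pdx (pdx U) x y = - 1\<^sup>2 * (pdy (pdy U) x y + (complex_of_real k)\<^sup>2 * U x y)"
      using pde[of x y] pdy_flux[of x y] D xy by (simp add: S'_inner algebra_simps add_eq_0_iff)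
    then show "((\<lambda>s. pdx U s y) has_vector_derivative
        - 1\<^sup>2 * (pdy (pdy U) x y + (complex_of_real k)\<^sup>2 * U x y)) (at x)"
      using C2_on_derivs(2)[OF C2 D] by simp
  next
    show "continuous_on ({0<..<L} \<times> {0..pi}) (\<lambda>(x, y). U x y)"
      by (rule continuous_on_subset[OF cont]) (auto simp: I_def)
    show "continuous_on ({0<..<L} \<times> {0<..<pi}) (\<lambda>(x, y). pdx U x y)"
      by (rule continuous_on_subset[OF C2_on_continuous(1)[OF C2]]) (auto simp: I_def)
    show "continuous_on ({0<..<L} \<times> {0<..<pi}) (\<lambda>(x, y). pdy (pdy U) x y)"
      by (rule continuous_on_subset[OF C2_on_continuous(2)[OF C2]]) (auto simp: I_def)
    show "U x 0 = 0 \<and> U x pi = 0" if "x \<in> {0<..<L}" for x using bd that by (simp add: I_def)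
  qed (auto simp: is_interval_oo)

  define V where "V = (\<lambda>r y. U (decompress r) y)"
  define Vx where "Vx = (\<lambda>r y. complex_of_real (decompress' r) * pdx U (decompress r) y)"
  define Vy where "Vy = (\<lambda>r y. pdy U (decompress r) y)"
  define Vyy where "Vyy = (\<lambda>r y. pdy (pdy U) (decompress r) y)"
  \<comment> \<open>The r-derivative of the field is \<open>speed\<close> times the flux. Both the
    modal equation and the interface condition in the layer rest on this.\<close>
  have Vx_eq: "Vx r y = speed * P (decompress r) y" if "r > 0" for r y
    using speed_nonzero S'_decompress[OF that] by (simp add: Vx_def P_def)
  have cd: "continuous_on {0<..} decompress"
    using decompress_deriv
    by (auto intro!: continuous_at_imp_continuous_on has_vector_derivative_continuous)
  have cd': "continuous_on {0<..} decompress'"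
    unfolding decompress'_def[abs_def] using d by (intro continuous_intros) auto
  have comp: "continuous_on ({0<..} \<times> A) (\<lambda>(r, y). f (decompress r) y)"
    if "continuous_on (I \<times> A) (\<lambda>(x, y). f x y)" for f :: "real \<Rightarrow> real \<Rightarrow> complex" and A
  proof -
    have "continuous_on ({0<..} \<times> A) (\<lambda>p. decompress (fst p))"
      by (rule continuous_on_compose2[OF cd]) (auto intro!: continuous_intros)
    then have "continuous_on ({0<..} \<times> A) (\<lambda>p. (\<lambda>(x, y). f x y) (decompress (fst p), snd p))"
      by (intro continuous_on_compose2[OF that] continuous_intros)
        (use decompress_in in \<open>auto simp: I_def\<close>)
    then show ?thesis by (simp add: case_prod_beta)
  qed
  interpret right: dirichlet_strip "{0<..}" speed k V Vx Vy Vyy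
  proof
    fix r y :: real assume ry: "r \<in> {0<..}" "y \<in> {0<..<pi}"
    then have r: "r > 0" by simp
    have xI: "decompress r \<in> I" using decompress_in[OF r] by (simp add: I_def)
    then have D: "(decompress r, y) \<in> I \<times> {0<..<pi}" using ry by simp
    show "((\<lambda>t. V r t) has_vector_derivative Vy r y) (at y)"
      and "((\<lambda>t. Vy r t) has_vector_derivative Vyy r y) (at y)"
      unfolding V_def Vy_def Vyy_def using C2_on_derivs(3,4)[OF C2 D] by auto
    show "((\<lambda>s. V s y) has_vector_derivative Vx r y) (at r)"
      using vector_diff_chain_at[OF decompress_deriv[OF r] C2_on_derivs(1)[OF C2 D]]
      by (simp add: V_def Vx_def o_def scaleR_conv_of_real)
    \<comment> \<open>In the layer \<open>1 / S'\<close> is a quadratic polynomial divided by a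
      constant. This shows that \<open>P\<close> is differentiable in x; the explicit derivative is
      then traded for \<open>pdx P\<close>.\<close>
    have inv: "((\<lambda>s. complex_of_real ((L + d - s)\<^sup>2 / d\<^sup>2) / speed) has_vector_derivative
        complex_of_real (- 2 * (L + d - decompress r) / d\<^sup>2) / speed) (at (decompress r))"
      by (intro has_vector_derivative_divide has_vector_derivative_of_real)
        (use d in \<open>auto intro!: derivative_eq_intros simp: divide_simps\<close>)
    have "((\<lambda>s. P s y) has_vector_derivative
        complex_of_real ((L + d - decompress r)\<^sup>2 / d\<^sup>2) / speed * pdx (pdx U) (decompress r) y
        + complex_of_real (- 2 * (L + d - decompress r) / d\<^sup>2) / speed * pdx U (decompress r) y)
        (at (decompress r))"
      by (rule has_vector_derivative_transform_within_open[
            OF has_vector_derivative_mult[OF inv C2_on_derivs(2)[OF C2 D]], of "{L<..<L + d}"])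
        (use decompress_in[OF r] d in \<open>auto simp: P_def S'_layer divide_simps\<close>)
    then have "((\<lambda>s. P s y) has_vector_derivative pdx P (decompress r) y) (at (decompress r))"
      unfolding pdx_def[of P] by (metis vector_derivative_at)
    from has_vector_derivative_mult_right[OF vector_diff_chain_at[OF decompress_deriv[OF r] this], of speed]
    have "((\<lambda>s. speed * P (decompress s) y) has_vector_derivative
        speed * (complex_of_real (decompress' r) * pdx P (decompress r) y)) (at r)"
      by (simp add: o_def scaleR_conv_of_real)
    then have "((\<lambda>s. Vx s y) has_vector_derivative
        speed * (complex_of_real (decompress' r) * pdx P (decompress r) y)) (at r)"
      by (rule has_vector_derivative_transform_within_open[of _ _ _ "{0<..}"]) (use r Vx_eq in auto)
    moreover have "pdx P (decompress r) y + S' (decompress r) * (Vyy r y + (complex_of_real k)\<^sup>2 * V r y) = 0"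
      using pde[OF xI ry(2)] unfolding pdy_flux[OF xI ry(2)]
      by (simp add: V_def Vyy_def algebra_simps)
    then have "pdx P (decompress r) y = - S' (decompress r) * (Vyy r y + (complex_of_real k)\<^sup>2 * V r y)"
      by (simp add: add_eq_0_iff2)
    \<comment> \<open>The factor \<open>decompress'\<close> cancels the denominator of
      \<open>S'\<close>, leaving the constant \<open>speed\<close> squared.\<close>
    then have "speed * (complex_of_real (decompress' r) * pdx P (decompress r) y)
        = - speed\<^sup>2 * (Vyy r y + (complex_of_real k)\<^sup>2 * V r y)"
      using decompress'_pos[OF r] by (simp add: S'_decompress[OF r] power2_eq_square)
    ultimately show "((\<lambda>s. Vx s y) has_vector_derivative
        - speed\<^sup>2 * (Vyy r y + (complex_of_real k)\<^sup>2 * V r y)) (at r)" by simp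
  next
    show "continuous_on ({0<..} \<times> {0..pi}) (\<lambda>(x, y). V x y)"
      unfolding V_def by (rule comp[OF cont])
    show "continuous_on ({0<..} \<times> {0<..<pi}) (\<lambda>(x, y). Vyy x y)"
      unfolding Vyy_def by (rule comp[OF C2_on_continuous(2)[OF C2]])
    have "continuous_on ({0<..} \<times> {0<..<pi}) (\<lambda>p. decompress' (fst p))"
      by (rule continuous_on_compose2[OF cd']) (auto intro!: continuous_intros)
    with comp[OF C2_on_continuous(1)[OF C2]]
    show "continuous_on ({0<..} \<times> {0<..<pi}) (\<lambda>(x, y). Vx x y)"
      unfolding Vx_def case_prod_beta by (intro continuous_intros)
    show "V r 0 = 0 \<and> V r pi = 0" if "r \<in> {0<..}" for r
      using bd decompress_in[of r] that by (simp add: V_def I_def)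
  qed auto

  obtain m1 where m: "\<And>x. x \<in> {0<..} \<Longrightarrow> ((\<lambda>s. sine_coeff l (V s)) has_vector_derivative m1 x) (at x)"
    and m1: "\<And>x. x \<in> {0<..} \<Longrightarrow> (m1 has_vector_derivative
      speed\<^sup>2 * ((of_nat l)\<^sup>2 - (complex_of_real k)\<^sup>2) * sine_coeff l (V x)) (at x)"
    and m1_flux: "\<And>x. x \<in> {0<..} \<Longrightarrow> square_integrable (Vx x) \<Longrightarrow> m1 x = sine_coeff l (Vx x)"
    by (rule right.sine_coeff_ode) blast
  have V0: "((\<lambda>r. sine_coeff l (V r)) \<longlongrightarrow> 0) at_top"
    using filterlim_compose[OF L2_tendsto_sine_coeff[OF end0, of l] decompress_at_top]
    by (simp add: V_def sine_coeff_def)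
  have "?b = 0 \<or> Re ?b < 0"
    unfolding speed_def using \<sigma>\<^sub>0 \<sigma>\<^sub>1 k by (intro compressed_khat_decay) auto
  then have m1_eq: "m1 r = ?b * sine_coeff l (V r)" if "r > 0" for r
    using decaying_solution[of "\<lambda>r. sine_coeff l (V r)" m1 ?b, OF _ _ V0 _ that] m m1
    unfolding b2 by auto
  have lim_h: "((\<lambda>r. ?b * sine_coeff l (V r)) \<longlongrightarrow> ?b * sine_coeff l h) (at_right 0)"
    unfolding V_def
    by (intro tendsto_mult_left filterlim_compose[OF L2_tendsto_sine_coeff[OF hr] decompress_at_right])
  have lim_v: "((\<lambda>r. speed * sine_coeff l (P (decompress r))) \<longlongrightarrow> speed * sine_coeff l v) (at_right 0)"
    by (intro tendsto_mult_left filterlim_compose[OF L2_tendsto_sine_coeff[OF vr] decompress_at_right])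
  have "\<forall>\<^sub>F r in at_right 0. speed * sine_coeff l (P (decompress r)) = ?b * sine_coeff l (V r)"
  proof -
    have "\<forall>\<^sub>F x in at_right L. square_integrable (P x)" using vr unfolding L2_tendsto_def by simp
    then have "\<forall>\<^sub>F r in at_right 0. square_integrable (P (decompress r))"
      by (rule eventually_compose_filterlim[OF _ decompress_at_right])
    with eventually_at_right_less[of 0] show ?thesis
    proof eventually_elim
      case (elim r)
      have eq: "Vx r = (\<lambda>y. speed * P (decompress r) y)" using Vx_eq[OF elim(1)] by auto
      have "square_integrable (Vx r)" unfolding eq by (rule square_integrable_scale[OF elim(2)])
      then have "m1 r = speed * sine_coeff l (P (decompress r))"
        using m1_flux elim(1) by (simp add: eq sine_coeff_scale)
      with m1_eq[OF elim(1)] show ?case by metis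
    qed
  qed
  from Lim_transform_eventually[OF lim_v this] lim_h
  have "speed * sine_coeff l v = ?b * sine_coeff l h"
    by (rule tendsto_unique[OF trivial_limit_at_right_real])
  \<comment> \<open>\<open>speed\<close> occurs on both sides and cancels: the ratio of flux to
    field at the interface is that of an outgoing wave in the unstretched guide.\<close>
  then have impedance: "sine_coeff l v = ?a * sine_coeff l h" using speed_nonzero by simp

  obtain n1 where n: "\<And>x. x \<in> {0<..<L} \<Longrightarrow> ((\<lambda>s. sine_coeff l (U s)) has_vector_derivative n1 x) (at x)"
    and n1: "\<And>x. x \<in> {0<..<L} \<Longrightarrow> (n1 has_vector_derivative
      1\<^sup>2 * ((of_nat l)\<^sup>2 - (complex_of_real k)\<^sup>2) * sine_coeff l (U x)) (at x)"
    and n1_flux: "\<And>x. x \<in> {0<..<L} \<Longrightarrow> square_integrable (pdx U x) \<Longrightarrow> n1 x = sine_coeff l (pdx U x)"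
    by (rule left.sine_coeff_ode) blast
  obtain C where C: "\<And>x. x \<in> {0<..<L} \<Longrightarrow> n1 x - ?a * sine_coeff l (U x) = C * exp (- ?a * of_real x)"
    by (rule second_order_factor[OF left.open_J left.interval_J n n1[folded a2]]) blast+
  \<comment> \<open>The trace condition concerns \<open>pdx U\<close>, so the limit is taken for its
    coefficients; close to \<open>L\<close> they agree with \<open>n1\<close>.\<close>
  have "((\<lambda>x. sine_coeff l (pdx U x) - ?a * sine_coeff l (U x)) \<longlongrightarrow> sine_coeff l v - ?a * sine_coeff l h) (at_left L)"
    by (intro tendsto_diff tendsto_mult_left L2_tendsto_sine_coeff vl hl)
  moreover have "\<forall>\<^sub>F x in at_left L. sine_coeff l (pdx U x) - ?a * sine_coeff l (U x) = C * exp (- ?a * of_real x)"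
  proof -
    have "\<forall>\<^sub>F x in at_left L. square_integrable (pdx U x)" using vl unfolding L2_tendsto_def by simp
    with eventually_at_left_real[OF L] show ?thesis
      by eventually_elim (metis C n1_flux)
  qed
  ultimately have "((\<lambda>x. C * exp (- ?a * of_real x)) \<longlongrightarrow> sine_coeff l v - ?a * sine_coeff l h) (at_left L)"
    by (rule Lim_transform_eventually)
  moreover have "((\<lambda>x. C * exp (- ?a * of_real x)) \<longlongrightarrow> C * exp (- ?a * of_real L)) (at_left L)"
    by (intro tendsto_intros)
  ultimately have "sine_coeff l v - ?a * sine_coeff l h = C * exp (- ?a * of_real L)"
    by (rule tendsto_unique[OF trivial_limit_at_left_real])
  \<comment> \<open>The left side is 0 and the exponential has no zeros.\<close>
  then have "C = 0" using impedance by simp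
  then have "n1 x = ?a * sine_coeff l (U x)" if "x \<in> {0<..<L}" for x using C[OF that] by simp
  then have "((\<lambda>s. sine_coeff l (U s)) has_vector_derivative ?a * sine_coeff l (U x)) (at x)"
    if "x \<in> {0<..<L}" for x using n[OF that] that by auto
  from first_order_from_trace[OF L this L2_tendsto_sine_coeff[OF g] x] show ?thesis .
qed

end

section \<open>From equal sine coefficients to equal cross-sections\<close>

text \<open>The modes are real, so the vanishing integrals split into real and imaginary parts, to
  which the real completeness result applies.\<close>

lemma sine_coeff_eq_imp_eq:
  fixes f1 f2 :: "real \<Rightarrow> complex"
  assumes c1: "continuous_on {0..pi} f1" and c2: "continuous_on {0..pi} f2"
    and eq: "\<And>l. l \<ge> 1 \<Longrightarrow> sine_coeff l f1 = sine_coeff l f2"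
    and y: "y \<in> {0<..<pi}"
  shows "f1 y = f2 y"
proof -
  have zero: "integral {0..pi} (\<lambda>y. (f1 y - f2 y) * complex_of_real (sin (real l * y))) = 0" if "l \<ge> 1" for l
    using eq[OF that] unfolding sine_coeff_def
    by (simp add: left_diff_distrib integral_diff integrable_continuous_real continuous_intros c1 c2)
  have int: "(\<lambda>y. (f1 y - f2 y) * complex_of_real (sin (real l * y))) integrable_on {0..pi}" for l
    by (intro integrable_continuous_real continuous_intros c1 c2)
  have "Re (f1 y - f2 y) = 0"
  proof (rule sine_system_complete[of "\<lambda>y. Re (f1 y - f2 y)", OF _ _ y])
    show "integral {0..pi} (\<lambda>y. Re (f1 y - f2 y) * sin (real l * y)) = 0" if "l \<ge> 1" for l
      using integral_linear[OF int[of l] bounded_linear_Re] zero[OF that] by (simp add: o_def)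
  qed (intro continuous_intros c1 c2)
  moreover have "Im (f1 y - f2 y) = 0"
  proof (rule sine_system_complete[of "\<lambda>y. Im (f1 y - f2 y)", OF _ _ y])
    show "integral {0..pi} (\<lambda>y. Im (f1 y - f2 y) * sin (real l * y)) = 0" if "l \<ge> 1" for l
      using integral_linear[OF int[of l] bounded_linear_Im] zero[OF that] by (simp add: o_def)
  qed (intro continuous_intros c1 c2)
  ultimately show ?thesis by (simp add: complex_eq_iff)
qed

theorem theorem2:
  fixes k L d \<sigma>\<^sub>0 \<sigma>\<^sub>1 :: real
    and g :: "real \<Rightarrow> complex"
    and U U\<^sub>a :: "real \<Rightarrow> real \<Rightarrow> complex"
  assumes "k > 0" and "L > 0" and "d > 0" and "\<sigma>\<^sub>0 > 0" and "\<sigma>\<^sub>1 > 0"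
    and "square_integrable g"
    and "waveguide_solution k g U"
    and "pal_solution k L d \<sigma>\<^sub>0 \<sigma>\<^sub>1 g U\<^sub>a"
  shows "\<forall>(x, y) \<in> {0<..<L} \<times> {0<..<pi}. U\<^sub>a x y = U x y"
proof safe
  interpret layer k L d \<sigma>\<^sub>0 \<sigma>\<^sub>1 by unfold_locales (use assms in auto)
  fix x y :: real assume x: "x \<in> {0<..<L}" and y: "y \<in> {0<..<pi}"
  show "U\<^sub>a x y = U x y"
  proof (rule sine_coeff_eq_imp_eq[OF _ _ _ y])
    show "continuous_on {0..pi} (U\<^sub>a x)"
      by (rule continuous_slice[of "{0<..<L} \<union> {L<..<L + d}"])
        (use assms(8) x in \<open>auto simp: pal_solution_def Let_def\<close>)
    show "continuous_on {0..pi} (U x)"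
      by (rule continuous_slice[of "{0<..}"]) (use assms(7) x in \<open>auto simp: waveguide_solution_def\<close>)
    show "sine_coeff l (U\<^sub>a x) = sine_coeff l (U x)" if "l \<ge> 1" for l
      using pal_sine_coeff[OF assms(8) x] waveguide_sine_coeff[OF assms(7) that] x by simp
  qed
qed

end
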